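(* Let $n\geq 1$ be an integer and let $E$ be a nonempty compact semi-algebraic subset of $[0,1]^n$. Then there exist an integer $N>n$ and an $N$-player binary game such that the projection of its set of Nash equilibria (a subset of $[0,1]^N$) on its first $n$ coordinates (those of the first $n$ players) is equal to $E$.
   Context: A game is binary if it is a finite normal-form game in which each player has exactly two pure strategies; payoffs of pure strategy profiles are arbitrary real numbers. Nash equilibria are understood in mixed strategies. A mixed strategy of the $i$-th player is identified with the probability $x_i\in[0,1]$ that it assigns to the first of her two pure strategies, so a mixed strategy profile of an $N$-player binary game is a vector $(x_1,\dots,x_N)\in[0,1]^N$, and the set of Nash equilibria is a subset of $[0,1]^N$. A subset of $\mathbb{R}^n$ is semi-algebraic if it may be obtained by finitely many unions and intersections of sets defined by a (real) polynomial equality or strict inequality. *)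

theory Defs
  imports "HOL-Analysis.Analysis"
begin

text \<open>
  Throughout, $\mathbb{R}^n$ is the carrier of \<^const>\<open>Euclidean_space\<close> \<open>n\<close>: the sequences
  \<open>nat \<Rightarrow> real\<close> that vanish at every index \<open>i \<ge> n\<close>.  Coordinates and players are
  numbered from 0, so the first \<open>n\<close> of them are those with index \<open>i < n\<close>.
\<close>

text \<open>
  A polynomial in \<open>n\<close> variables is a finite sum of monomials; a monomial is given by its
  exponent vector \<open>m\<close>, of which only the entries below \<open>n\<close> matter.
\<close>

definition polynomial_fun :: "nat \<Rightarrow> ((nat \<Rightarrow> real) \<Rightarrow> real) \<Rightarrow> bool" where
  "polynomial_fun n p \<longleftrightarrow>
     (\<exists>(M :: (nat \<Rightarrow> nat) set) c. finite M \<and> p = (\<lambda>x. \<Sum>m\<in>M. c m * (\<Prod>i<n. x i ^ m i)))"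

inductive semialgebraic :: "nat \<Rightarrow> (nat \<Rightarrow> real) set \<Rightarrow> bool" for n :: nat where
  eq_zero: "polynomial_fun n p \<Longrightarrow> semialgebraic n {x \<in> topspace (Euclidean_space n). p x = 0}"
| pos: "polynomial_fun n p \<Longrightarrow> semialgebraic n {x \<in> topspace (Euclidean_space n). p x > 0}"
| union: "semialgebraic n A \<Longrightarrow> semialgebraic n B \<Longrightarrow> semialgebraic n (A \<union> B)"
| inter: "semialgebraic n A \<Longrightarrow> semialgebraic n B \<Longrightarrow> semialgebraic n (A \<inter> B)"

definition unit_cube :: "nat \<Rightarrow> (nat \<Rightarrow> real) set" where
  "unit_cube n = {x \<in> topspace (Euclidean_space n). \<forall>i<n. 0 \<le> x i \<and> x i \<le> 1}"

definition proj_first :: "nat \<Rightarrow> (nat \<Rightarrow> real) \<Rightarrow> (nat \<Rightarrow> real)" where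
  "proj_first n x = (\<lambda>i. if i < n then x i else 0)"

text \<open>
  A binary game with players \<open>0, \<dots>, N - 1\<close> is given by \<open>N\<close> and its payoff function \<open>u\<close>:
  \<open>u i s\<close> is the payoff of player \<open>i\<close> at the pure strategy profile \<open>s\<close>, where \<open>s j = True\<close>
  means that player \<open>j\<close> uses the first of her two pure strategies.  Only the values of \<open>u\<close>
  at players \<open>i < N\<close> and pure profiles of the \<open>N\<close> players are ever used.
\<close>

type_synonym payoffs = "nat \<Rightarrow> (nat \<Rightarrow> bool) \<Rightarrow> real"

definition pure_profiles :: "nat \<Rightarrow> (nat \<Rightarrow> bool) set" where
  "pure_profiles N = ({..<N} \<rightarrow>\<^sub>E UNIV)"

definition expected_payoff :: "nat \<Rightarrow> payoffs \<Rightarrow> nat \<Rightarrow> (nat \<Rightarrow> real) \<Rightarrow> real" where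
  "expected_payoff N u i x =
     (\<Sum>s\<in>pure_profiles N. (\<Prod>j<N. if s j then x j else 1 - x j) * u i s)"

text \<open>Mixed strategy profiles are the points of the unit cube; \<open>y\<close> is a unilateral deviation.\<close>

definition nash_equilibria :: "nat \<Rightarrow> payoffs \<Rightarrow> (nat \<Rightarrow> real) set" where
  "nash_equilibria N u =
     {x \<in> unit_cube N. \<forall>i<N. \<forall>y\<in>{0..1}.
        expected_payoff N u i (x(i := y)) \<le> expected_payoff N u i x}"

end

theory Submission
  imports Defs
begin

text \<open>
  Binary games compute: a pair of players playing matching pennies forces one of them to play the
  value of a given multi-affine function of the other strategies, clamped to \<open>[0, 1]\<close>. Hence if
  \<open>E\<close> is the subset of the cube where some function built from polynomials by sums, products and
  clamping is nonpositive, a further player can watch this function and draw the first \<open>n\<close> players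
  to a fixed point of \<open>E\<close> whenever it is positive. To describe \<open>E\<close> by such closed conditions,
  every sign vector that occurs only outside \<open>E\<close> is excluded by an inequality
  \<open>g ^ N \<le> C * f\<close> which holds on \<open>E\<close> by Lojasiewicz' inequality. The latter follows from the
  Tarski--Seidenberg theorem, which is obtained by the method of Cohen and Hormander: when
  finitely many polynomials of \<open>x\<close> have the same signs at \<open>x\<close> and \<open>x'\<close>, an increasing bijection of
  the real line matches the signs of \<open>p x\<close> and \<open>p x'\<close> for all \<open>p\<close> of a given finite family of
  polynomials in one more variable.
\<close>

section \<open>Matching the signs of real polynomials\<close>

text \<open>The first obstacle is that a semi-algebraic description may use strict inequalities,
  whereas a game can only test a condition \<open>\<phi> \<le> 0\<close> with \<open>\<phi>\<close>
  continuous. Relaxing the strict inequalities in a description of \<open>E\<close> may add points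
  even though \<open>E\<close> is closed, so a different closed description has to be produced; a
  quantitative inequality valid on \<open>E\<close> is what separates it from a forbidden sign
  vector. Quantifier elimination is never carried out on formulas. A set counts as semi-algebraic as
  soon as membership depends only on the signs of finitely many polynomials, and projection then
  becomes a statement about two points with equal signs: the bijection carries a witness over one of
  them to a witness over the other. The second obstacle is that expected payoffs are affine in each
  single strategy and that the incentive of a player cannot involve her own strategy. Squares, and
  any reaction of a player to herself, are therefore obtained by copying a value to a fresh
  player.\<close>

definition incbij :: "(real \<Rightarrow> real) \<Rightarrow> bool" where
  "incbij \<theta> \<longleftrightarrow> strict_mono \<theta> \<and> surj \<theta>"

lemma incbij_id: "incbij (\<lambda>y. y)"
  by (auto simp: incbij_def strict_mono_def)

lemma incbij_comp: "incbij \<theta> \<Longrightarrow> incbij \<eta> \<Longrightarrow> incbij (\<lambda>y. \<eta> (\<theta> y))"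
  using comp_surj[of \<theta> \<eta>] by (auto simp: incbij_def strict_mono_def comp_def)

lemma incbij_less_iff: "incbij \<theta> \<Longrightarrow> \<theta> x < \<theta> y \<longleftrightarrow> x < y"
  by (simp add: incbij_def strict_mono_less)

lemma incbij_le_iff: "incbij \<theta> \<Longrightarrow> \<theta> x \<le> \<theta> y \<longleftrightarrow> x \<le> y"
  by (simp add: incbij_def strict_mono_less_eq)

lemma incbij_surjE:
  assumes "incbij \<theta>" obtains u where "\<theta> u = v"
  using assms by (metis incbij_def surjD)

definition kink :: "real \<Rightarrow> real \<Rightarrow> real \<Rightarrow> real" where
  "kink c r y = (if y \<le> c then y else c + r * (y - c))"

lemma incbij_kink:
  assumes "r > 0"
  shows "incbij (kink c r)"
proof -
  have "kink c r x < kink c r y" if "x < y" for x y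
  proof -
    have "r * (x - c) < r * (y - c)" using that assms by simp
    moreover have "r * (y - c) > 0" if "y > c" using that assms by simp
    ultimately show ?thesis using that by (auto simp: kink_def intro: add_strict_increasing)
  qed
  moreover have "\<exists>x. kink c r x = y" for y
  proof (cases "y \<le> c")
    case True then show ?thesis by (auto simp: kink_def intro: exI[of _ y])
  next
    case False
    then have "(y - c) / r > 0" using assms by simp
    then have "kink c r (c + (y - c) / r) = y" using assms by (simp add: kink_def)
    then show ?thesis by blast
  qed
  ultimately show ?thesis unfolding incbij_def strict_mono_def surj_def by metis
qed

text \<open>A piecewise linear map with slope \<open>r1\<close> from \<open>a\<close> to
  \<open>u\<close>, slope \<open>r2\<close> from \<open>u\<close> to \<open>b\<close>, and slope 1
  elsewhere. Each \<open>kink\<close> changes the slope once and is the identity to the left, so the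
  later factors break at the values \<open>v\<close> and \<open>b\<close> reached so far.\<close>

lemma incbij_move_point:
  assumes "a < u" "u < b" "a < v" "v < b"
  obtains \<alpha> where "incbij \<alpha>" "\<alpha> u = v" "\<And>y. y \<le> a \<or> b \<le> y \<Longrightarrow> \<alpha> y = y"
proof -
  define r1 where "r1 = (v - a) / (u - a)"
  define r2 where "r2 = (b - v) / (b - u)"
  define \<alpha> where "\<alpha> y = kink b (1 / r2) (kink v (r2 / r1) (kink a r1 y))" for y
  have r: "r1 > 0" "r2 > 0" using assms by (auto simp: r1_def r2_def)
  have k1: "kink a r1 y = v + r1 * (y - u)" if "y > a" for y
  proof -
    have "r1 * (u - a) = v - a" using assms by (simp add: r1_def)
    then show ?thesis using that by (simp add: kink_def algebra_simps)
  qed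
  have k2: "kink v (r2 / r1) (kink a r1 y) = b + r2 * (y - b)" if "y > u" for y
  proof -
    have "r2 * (b - u) = b - v" using assms by (simp add: r2_def)
    moreover have "r1 * (y - u) > 0" using that r by simp
    ultimately show ?thesis using that r assms by (simp add: k1) (simp add: kink_def algebra_simps)
  qed
  have pos: "r2 / r1 > 0" "1 / r2 > 0" using r by auto
  have "incbij \<alpha>"
    using incbij_comp[OF incbij_comp[OF incbij_kink[OF r(1)] incbij_kink[OF pos(1)]] incbij_kink[OF pos(2)]]
    unfolding \<alpha>_def .
  moreover have "\<alpha> u = v"
  proof -
    have "kink a r1 u = v" using assms k1[of u] by simp
    then show ?thesis using assms unfolding \<alpha>_def by (simp add: kink_def)
  qed
  moreover have "\<alpha> y = y" if "y \<le> a" for y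
    using that assms by (simp add: \<alpha>_def kink_def)
  moreover have "\<alpha> y = y" if "b \<le> y" for y
  proof -
    have "r2 * (y - b) \<ge> 0" using that r by simp
    moreover have "\<alpha> y = kink b (1 / r2) (b + r2 * (y - b))"
      using that assms k2[of y] by (simp add: \<alpha>_def)
    ultimately show ?thesis using that r by (cases "y = b") (auto simp: kink_def mult_le_0_iff)
  qed
  ultimately show thesis using that by blast
qed

section \<open>Signs of a polynomial on an interval\<close>

lemma sgn_poly_const:
  fixes p :: "real poly"
  assumes "x \<le> y" "\<And>z. x \<le> z \<Longrightarrow> z \<le> y \<Longrightarrow> poly p z \<noteq> 0"
  shows "sgn (poly p x) = sgn (poly p y)"
proof (rule ccontr)
  assume neq: "\<not> ?thesis"
  then have "x < y" using assms(1) by (cases "x = y") auto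
  have "poly p x \<noteq> 0" "poly p y \<noteq> 0" using assms by auto
  then have "poly p x < 0 \<and> poly p y > 0 \<or> poly p x > 0 \<and> poly p y < 0"
    using neq by (auto simp: sgn_if split: if_splits)
  then obtain z where "x < z" "z < y" "poly p z = 0"
    using poly_IVT_pos[OF \<open>x < y\<close>, of p] poly_IVT_neg[OF \<open>x < y\<close>, of p] by blast
  then show False using assms(2)[of z] by simp
qed

lemma sgn_poly_const_open:
  fixes p :: "real poly"
  assumes "\<And>z. a < z \<Longrightarrow> z < b \<Longrightarrow> poly p z \<noteq> 0" "a < x" "x < b" "a < y" "y < b"
  shows "sgn (poly p x) = sgn (poly p y)"
proof (cases "x \<le> y")
  case True
  then show ?thesis using assms by (intro sgn_poly_const) auto
next
  case False
  then have "sgn (poly p y) = sgn (poly p x)" using assms by (intro sgn_poly_const) auto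
  then show ?thesis by simp
qed

text \<open>The derivative keeps one sign inside the interval, so the mean value slopes to the left
  and to the right of the root \<open>w\<close> have equal signs.\<close>

lemma poly_root_opposite_ends:
  fixes p :: "real poly"
  assumes "a < w" "w < b" "poly p w = 0"
    and nr: "\<And>z. a < z \<Longrightarrow> z < b \<Longrightarrow> poly (pderiv p) z \<noteq> 0"
  shows "sgn (poly p b) = - sgn (poly p a)" "poly p a \<noteq> 0"
proof -
  obtain x where x: "a < x" "x < w" "poly p w - poly p a = (w - a) * poly (pderiv p) x"
    using poly_MVT[OF assms(1)] by blast
  obtain y where y: "w < y" "y < b" "poly p b - poly p w = (b - w) * poly (pderiv p) y"
    using poly_MVT[OF assms(2)] by blast
  have s: "sgn (poly (pderiv p) x) = sgn (poly (pderiv p) y)"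
    by (rule sgn_poly_const_open[of a b]) (use nr x y assms in auto)
  have "poly p a = - ((w - a) * poly (pderiv p) x)" using x assms by simp
  moreover have "poly p b = (b - w) * poly (pderiv p) y" using y assms by simp
  moreover have "poly (pderiv p) x \<noteq> 0" using nr x assms by auto
  ultimately show "sgn (poly p b) = - sgn (poly p a)" "poly p a \<noteq> 0"
    using s assms by (auto simp: sgn_mult)
qed

lemma poly_opposite_ends_root:
  fixes p :: "real poly"
  assumes "a < b" "sgn (poly p b) = - sgn (poly p a)" "poly p a \<noteq> 0"
  obtains w where "a < w" "w < b" "poly p w = 0"
proof -
  have "poly p a < 0 \<and> poly p b > 0 \<or> poly p a > 0 \<and> poly p b < 0"
    using assms by (auto simp: sgn_if split: if_splits)
  then show thesis
    using that poly_IVT_pos[OF \<open>a < b\<close>, of p] poly_IVT_neg[OF \<open>a < b\<close>, of p] by blast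
qed

lemma poly_Rolle:
  fixes p :: "real poly"
  assumes "poly p x = poly p y" "x \<noteq> y"
  obtains z where "min x y < z" "z < max x y" "poly (pderiv p) z = 0"
proof (cases "x < y")
  case True
  then show thesis using poly_MVT[OF True, of p] assms that by auto
next
  case False
  then have "y < x" using assms by simp
  then show thesis using poly_MVT[of y x p] assms that by auto
qed

section \<open>Matching families of polynomials by one bijection\<close>

definition sgn_match :: "(real \<Rightarrow> real) \<Rightarrow> real poly \<Rightarrow> real poly \<Rightarrow> real \<Rightarrow> bool" where
  "sgn_match \<theta> p q y \<longleftrightarrow> sgn (poly q (\<theta> y)) = sgn (poly p y)"

lemma sgn_match_zero: "sgn_match \<theta> p q y \<Longrightarrow> poly q (\<theta> y) = 0 \<longleftrightarrow> poly p y = 0"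
  unfolding sgn_match_def by (metis sgn_zero_iff)

text \<open>No nonzero member of \<open>F\<close> has a root inside the gap, so
  \<open>\<theta>\<close> may be deformed there without spoiling the matches already achieved. The
  derivative of \<open>p\<close> is such a member, hence \<open>p\<close> and \<open>q\<close> are
  monotone on the gap and have at most one root each; an interior root exists exactly when the signs
  at the ends are opposite and nonzero.\<close>

lemma sgn_match_gap:
  assumes \<theta>: "incbij \<theta>" and "a < b"
    and F: "\<And>f g y. (f, g) \<in> F \<Longrightarrow> sgn_match \<theta> f g y"
    and der: "(pderiv p, pderiv q) \<in> F"
    and nr: "\<And>f g y. (f, g) \<in> F \<Longrightarrow> f \<noteq> 0 \<Longrightarrow> a < y \<Longrightarrow> y < b \<Longrightarrow> poly f y \<noteq> 0"
    and nz: "pderiv p \<noteq> 0"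
    and ends: "sgn_match \<theta> p q a" "sgn_match \<theta> p q b"
  obtains \<eta> where "incbij \<eta>" "\<And>f g y. (f, g) \<in> F \<Longrightarrow> sgn_match \<eta> f g y"
    "\<And>y. y \<le> a \<or> b \<le> y \<Longrightarrow> \<eta> y = \<theta> y" "\<And>y. a < y \<Longrightarrow> y < b \<Longrightarrow> sgn_match \<eta> p q y"
proof -
  have dp: "poly (pderiv p) y \<noteq> 0" if "a < y" "y < b" for y
    using nr[OF der nz] that .
  have dq: "poly (pderiv q) y \<noteq> 0" if "\<theta> a < y" "y < \<theta> b" for y
  proof -
    obtain u where u: "\<theta> u = y" using incbij_surjE[OF \<theta>] by blast
    then have "a < u" "u < b" using that incbij_less_iff[OF \<theta>] by auto
    then show ?thesis using dp[of u] sgn_match_zero[OF F[OF der, of u]] u by auto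
  qed
  have ab': "\<theta> a < \<theta> b" using \<open>a < b\<close> incbij_less_iff[OF \<theta>] by auto
  have e: "sgn (poly q (\<theta> a)) = sgn (poly p a)" "sgn (poly q (\<theta> b)) = sgn (poly p b)"
    using ends by (auto simp: sgn_match_def)
  have e0: "poly q (\<theta> a) = 0 \<longleftrightarrow> poly p a = 0" "poly q (\<theta> b) = 0 \<longleftrightarrow> poly p b = 0"
    using ends sgn_match_zero by auto
  show thesis
  proof (cases "\<exists>w. a < w \<and> w < b \<and> poly p w = 0")
    case True
    then obtain w where w: "a < w" "w < b" "poly p w = 0" by blast
    note o = poly_root_opposite_ends[OF w dp]
    \<comment> \<open>The root of \<open>p\<close> makes its signs at the ends opposite and nonzero,
      and the matches at the ends hand this on to \<open>q\<close>.\<close>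
    obtain w' where w': "\<theta> a < w'" "w' < \<theta> b" "poly q w' = 0"
      using poly_opposite_ends_root[OF ab', of q] o e e0 by auto
    note o' = poly_root_opposite_ends[OF w' dq]
    have lw: "\<theta> a < \<theta> w" "\<theta> w < \<theta> b" using w incbij_less_iff[OF \<theta>] by auto
    obtain \<alpha> where \<alpha>: "incbij \<alpha>" "\<alpha> (\<theta> w) = w'" "\<And>y. y \<le> \<theta> a \<or> \<theta> b \<le> y \<Longrightarrow> \<alpha> y = y"
      using incbij_move_point[OF lw w'(1,2)] by blast
    define \<eta> where "\<eta> y = \<alpha> (\<theta> y)" for y
    have \<eta>: "incbij \<eta>" unfolding \<eta>_def using incbij_comp \<theta> \<alpha>(1) .
    have out: "\<eta> y = \<theta> y" if "y \<le> a \<or> b \<le> y" for y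
      using that \<alpha>(3) incbij_le_iff[OF \<theta>] by (auto simp: \<eta>_def)
    have \<eta>w: "\<eta> w = w'" by (simp add: \<eta>_def \<alpha>)
    have mF: "sgn_match \<eta> f g y" if fg: "(f, g) \<in> F" for f g y
    proof (cases "a < y \<and> y < b")
      case True
      then have "\<eta> a < \<eta> y" "\<eta> y < \<eta> b" using incbij_less_iff[OF \<eta>] by auto
      then have 1: "\<theta> a < \<eta> y" "\<eta> y < \<theta> b" using out[of a] out[of b] by auto
      \<comment> \<open>The deformed image of \<open>y\<close> is the old image of some
        \<open>u\<close> in the same gap, where \<open>f\<close> has the same sign as at
        \<open>y\<close>.\<close>
      obtain u where u: "\<theta> u = \<eta> y" using incbij_surjE[OF \<theta>] by blast
      then have ub: "a < u" "u < b" using 1 incbij_less_iff[OF \<theta>] by metis+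
      have "sgn (poly f u) = sgn (poly f y)"
      proof (cases "f = 0")
        case False
        show ?thesis by (rule sgn_poly_const_open[of a b]) (use nr[OF fg False] ub True in auto)
      qed auto
      then show ?thesis using F[OF fg, of u] u by (simp add: sgn_match_def)
    next
      case False
      then show ?thesis using F[OF fg, of y] out[of y] by (auto simp: sgn_match_def)
    qed
    have uniq: "poly p z \<noteq> 0" if "a \<le> z" "z \<le> b" and ne: "z \<noteq> w" for z
    proof
      assume "poly p z = 0"
      then obtain y where "min z w < y" "y < max z w" "poly (pderiv p) y = 0"
        by (metis poly_Rolle ne w(3))
      then show False using dp[of y] that w by auto
    qed
    have uniq': "poly q z \<noteq> 0" if "\<theta> a \<le> z" "z \<le> \<theta> b" and ne: "z \<noteq> w'" for z
    proof
      assume "poly q z = 0"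
      then obtain y where "min z w' < y" "y < max z w'" "poly (pderiv q) y = 0"
        by (metis poly_Rolle ne w'(3))
      then show False using dq[of y] that w' by auto
    qed
    have "sgn_match \<eta> p q y" if y: "a < y" "y < b" for y
    proof -
      have ly: "\<theta> a < \<eta> y" "\<eta> y < \<theta> b"
        using y incbij_less_iff[OF \<eta>, of a y] incbij_less_iff[OF \<eta>, of y b] out[of a] out[of b]
        by auto
      consider "y < w" | "y = w" | "y > w" by linarith
      then show ?thesis
      proof cases
        case 1
        then have "\<eta> y < w'" using incbij_less_iff[OF \<eta>] \<eta>w by metis
        then have "sgn (poly q (\<theta> a)) = sgn (poly q (\<eta> y))"
          using ly by (intro sgn_poly_const uniq') auto
        moreover have "sgn (poly p a) = sgn (poly p y)"
          using y 1 by (intro sgn_poly_const uniq) auto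
        ultimately show ?thesis using e by (simp add: sgn_match_def)
      next
        case 2
        then show ?thesis using w w' \<eta>w by (simp add: sgn_match_def)
      next
        case 3
        then have "w' < \<eta> y" using incbij_less_iff[OF \<eta>] \<eta>w by metis
        then have "sgn (poly q (\<eta> y)) = sgn (poly q (\<theta> b))"
          using ly by (intro sgn_poly_const uniq') auto
        moreover have "sgn (poly p y) = sgn (poly p b)"
          using y 3 by (intro sgn_poly_const uniq) auto
        ultimately show ?thesis using e by (simp add: sgn_match_def)
      qed
    qed
    with \<eta> mF out show thesis using that by blast
  next
    case False
    then have np: "poly p y \<noteq> 0" if "a < y" "y < b" for y using that by blast
    have nq: "poly q y \<noteq> 0" if y: "\<theta> a < y" "y < \<theta> b" for y
    proof
      assume "poly q y = 0"
      note o' = poly_root_opposite_ends[OF y this dq]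
      show False using poly_opposite_ends_root[OF \<open>a < b\<close>, of p] o' e e0 np by metis
    qed
    have "sgn_match \<theta> p q y" if y: "a < y" "y < b" for y
    proof -
      have ly: "\<theta> a < \<theta> y" "\<theta> y < \<theta> b" using y incbij_less_iff[OF \<theta>] by auto
      show ?thesis
      proof (cases "poly p a = 0")
        case False
        have "sgn (poly p a) = sgn (poly p y)"
          using y False np by (intro sgn_poly_const) (auto simp: le_less)
        moreover have "sgn (poly q (\<theta> a)) = sgn (poly q (\<theta> y))"
          using ly False e0 nq by (intro sgn_poly_const) (auto simp: le_less)
        ultimately show ?thesis using e by (simp add: sgn_match_def)
      next
        \<comment> \<open>A root at \<open>a\<close> rules out one at \<open>b\<close>, so signs are
          compared with the right end instead.\<close>
        case True
        have "poly p b \<noteq> 0"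
          using poly_MVT[OF \<open>a < b\<close>, of p] True dp \<open>a < b\<close> by auto
        then have "sgn (poly p y) = sgn (poly p b)" "sgn (poly q (\<theta> y)) = sgn (poly q (\<theta> b))"
          using y ly e0 np nq by (auto intro!: sgn_poly_const simp: le_less)
        then show ?thesis using e by (simp add: sgn_match_def)
      qed
    qed
    with \<theta> F show thesis using that by blast
  qed
qed

lemma sgn_poly_at_top:
  fixes p :: "real poly"
  assumes "p \<noteq> 0"
  obtains B where "\<And>y. B \<le> y \<Longrightarrow> sgn (poly p y) = sgn (lead_coeff p)"
proof (cases "lead_coeff p > 0")
  case True
  then obtain B where "\<And>x. x \<ge> B \<Longrightarrow> poly p x \<ge> lead_coeff p"
    using poly_pinfty_gt_lc by blast
  then show thesis using that[of B] True by (metis less_le_trans sgn_pos)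
next
  case False
  then have neg: "lead_coeff p < 0" using assms by (simp add: less_le)
  then obtain B where "\<And>x. x \<ge> B \<Longrightarrow> poly (-p) x \<ge> lead_coeff (-p)"
    using poly_pinfty_gt_lc[of "-p"] by auto
  then have "\<And>x. x \<ge> B \<Longrightarrow> poly p x < 0" using neg by fastforce
  then show thesis using that[of B] neg by (metis sgn_neg)
qed

lemma sgn_poly_at_bot:
  fixes p :: "real poly"
  assumes "p \<noteq> 0"
  obtains B where "\<And>y. y \<le> B \<Longrightarrow> sgn (poly p y) = (- 1) ^ degree p * sgn (lead_coeff p)"
proof -
  define q where "q = pcompose p [:0, -1:]"
  have "q \<noteq> 0" using assms by (simp add: q_def pcompose_eq_0_iff)
  obtain B where B: "\<And>y. B \<le> y \<Longrightarrow> sgn (poly q y) = sgn (lead_coeff q)"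
    using sgn_poly_at_top[OF \<open>q \<noteq> 0\<close>] by blast
  have lc: "lead_coeff q = (- 1) ^ degree p * lead_coeff p"
    unfolding q_def by (subst lead_coeff_comp) auto
  show thesis
  proof (rule that[of "-B"])
    fix y assume "y \<le> -B"
    moreover have "sgn ((- 1) ^ degree p :: real) = (- 1) ^ degree p"
      by (cases "even (degree p)") auto
    ultimately show "sgn (poly p y) = (- 1) ^ degree p * sgn (lead_coeff p)"
      using B[of "-y"] lc by (simp add: q_def poly_pcompose sgn_mult)
  qed
qed

text \<open>Far out the signs of \<open>p\<close> and \<open>q\<close> come from degree and leading
  coefficient, at the roots of \<open>F\<close> they match by hypothesis, and each of the finitely
  many gaps in between is repaired on its own by \<open>sgn_match_gap\<close>.\<close>

lemma sgn_match_insert: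
  assumes fin: "finite F" and \<theta>: "incbij \<theta>"
    and F: "\<And>f g y. (f, g) \<in> F \<Longrightarrow> sgn_match \<theta> f g y"
    and der: "(pderiv p, pderiv q) \<in> F"
    and deg: "degree p = degree q" "degree p > 0" "sgn (lead_coeff p) = sgn (lead_coeff q)"
    and roots: "\<And>f g y. (f, g) \<in> F \<Longrightarrow> f \<noteq> 0 \<Longrightarrow> poly f y = 0 \<Longrightarrow> sgn_match \<theta> p q y"
  obtains \<eta> where "incbij \<eta>" "\<And>f g y. (f, g) \<in> insert (p, q) F \<Longrightarrow> sgn_match \<eta> f g y"
proof -
  have nz: "pderiv p \<noteq> 0" "p \<noteq> 0" "q \<noteq> 0" using deg by (auto simp: pderiv_eq_0_iff)
  define Z0 where "Z0 = (\<Union>f\<in>{f\<in>fst ` F. f \<noteq> 0}. {y. poly f y = 0})"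
  have finZ0: "finite Z0" unfolding Z0_def using fin by (auto intro: poly_roots_finite)
  obtain B1 where B1: "\<And>y. B1 \<le> y \<Longrightarrow> sgn (poly p y) = sgn (lead_coeff p)"
    using sgn_poly_at_top[OF nz(2)] by blast
  obtain B2 where B2: "\<And>y. B2 \<le> y \<Longrightarrow> sgn (poly q y) = sgn (lead_coeff q)"
    using sgn_poly_at_top[OF nz(3)] by blast
  obtain B2' where B2': "\<theta> B2' = B2" using incbij_surjE[OF \<theta>] by blast
  obtain C1 where C1: "\<And>y. y \<le> C1 \<Longrightarrow> sgn (poly p y) = (- 1) ^ degree p * sgn (lead_coeff p)"
    using sgn_poly_at_bot[OF nz(2)] by blast
  obtain C2 where C2: "\<And>y. y \<le> C2 \<Longrightarrow> sgn (poly q y) = (- 1) ^ degree q * sgn (lead_coeff q)"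
    using sgn_poly_at_bot[OF nz(3)] by blast
  obtain C2' where C2': "\<theta> C2' = C2" using incbij_surjE[OF \<theta>] by blast
  \<comment> \<open>The constants 0 and 1 ensure \<open>L < U\<close>. \<open>B2'\<close> and
    \<open>C2'\<close> are the bounds for \<open>q\<close> pulled back through
    \<open>\<theta>\<close>.\<close>
  define U where "U = Max ({1, B1, B2'} \<union> Z0)"
  define L where "L = Min ({0, C1, C2'} \<union> Z0)"
  have U_ge: "y \<le> U" if "y \<in> {1, B1, B2'} \<union> Z0" for y
    unfolding U_def using finZ0 that by (intro Max_ge) auto
  have L_le: "L \<le> y" if "y \<in> {0, C1, C2'} \<union> Z0" for y
    unfolding L_def using finZ0 that by (intro Min_le) auto
  have "L < U" using U_ge[of 1] L_le[of 0] by simp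
  have top: "sgn_match \<theta> p q y" if "U \<le> y" for y
  proof -
    have "B1 \<le> y" "\<theta> B2' \<le> \<theta> y" using that \<theta> U_ge[of B1] U_ge[of B2'] by (auto simp: incbij_le_iff)
    then show ?thesis using B1[of y] B2[of "\<theta> y"] B2' deg by (simp add: sgn_match_def)
  qed
  have bot: "sgn_match \<theta> p q y" if "y \<le> L" for y
  proof -
    have "y \<le> C1" "\<theta> y \<le> \<theta> C2'" using that \<theta> L_le[of C1] L_le[of C2'] by (auto simp: incbij_le_iff)
    then show ?thesis using C1[of y] C2[of "\<theta> y"] C2' deg by (simp add: sgn_match_def)
  qed
  define Z where "Z = insert L (insert U Z0)"
  have finZ: "finite Z" using finZ0 by (simp add: Z_def)
  have Zm: "sgn_match \<theta> p q z" if "z \<in> Z" for z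
    using that top bot roots by (fastforce simp: Z_def Z0_def)
  have Zr: "y \<in> Z" if "(f, g) \<in> F" "f \<noteq> 0" "poly f y = 0" for f g y
    using that by (force simp: Z_def Z0_def)
  define consec where "consec a b \<longleftrightarrow> a \<in> Z \<and> b \<in> Z \<and> a < b \<and> (\<forall>z\<in>Z. z \<le> a \<or> b \<le> z)" for a b
  \<comment> \<open>Induction over the set \<open>T\<close> of left ends of gaps already repaired.
    Points of \<open>Z\<close> and points beyond \<open>L\<close> and \<open>U\<close> keep their
    images, so \<open>Zm\<close> still applies at the ends of the next gap.\<close>
  have "\<exists>\<eta>. incbij \<eta> \<and> (\<forall>f g y. (f, g) \<in> F \<longrightarrow> sgn_match \<eta> f g y) \<and>
      (\<forall>y. y \<in> Z \<or> y \<le> L \<or> U \<le> y \<longrightarrow> \<eta> y = \<theta> y) \<and>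
      (\<forall>a\<in>T. \<forall>b y. consec a b \<and> a < y \<and> y < b \<longrightarrow> sgn_match \<eta> p q y)" if "finite T" for T
    using that
  proof induction
    case empty
    then show ?case using \<theta> F by blast
  next
    case (insert a T)
    then obtain \<eta> where \<eta>: "incbij \<eta>" "\<And>f g y. (f, g) \<in> F \<Longrightarrow> sgn_match \<eta> f g y"
      "\<And>y. y \<in> Z \<or> y \<le> L \<or> U \<le> y \<Longrightarrow> \<eta> y = \<theta> y"
      "\<And>a b y. a \<in> T \<Longrightarrow> consec a b \<Longrightarrow> a < y \<Longrightarrow> y < b \<Longrightarrow> sgn_match \<eta> p q y"
      by blast
    show ?case
    proof (cases "\<exists>b. consec a b")
      case False
      then show ?thesis using \<eta> by blast
    next
      case True
      then obtain b where b: "consec a b" by blast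
      then have ab: "a \<in> Z" "b \<in> Z" "a < b" "\<And>z. z \<in> Z \<Longrightarrow> z \<le> a \<or> b \<le> z"
        by (auto simp: consec_def)
      have "sgn_match \<eta> p q a" "sgn_match \<eta> p q b"
        using Zm[OF ab(1)] Zm[OF ab(2)] \<eta>(3)[of a] \<eta>(3)[of b] ab by (auto simp: sgn_match_def)
      moreover have "\<And>f g y. (f, g) \<in> F \<Longrightarrow> f \<noteq> 0 \<Longrightarrow> a < y \<Longrightarrow> y < b \<Longrightarrow> poly f y \<noteq> 0"
        using Zr ab(4) by fastforce
      ultimately obtain \<kappa> where \<kappa>: "incbij \<kappa>" "\<And>f g y. (f, g) \<in> F \<Longrightarrow> sgn_match \<kappa> f g y"
        "\<And>y. y \<le> a \<or> b \<le> y \<Longrightarrow> \<kappa> y = \<eta> y" "\<And>y. a < y \<Longrightarrow> y < b \<Longrightarrow> sgn_match \<kappa> p q y"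
        using sgn_match_gap[OF \<eta>(1) ab(3) \<eta>(2) der _ nz(1)] by metis
      have "L \<le> a" "b \<le> U" using L_le[of a] U_ge[of b] \<open>L < U\<close> ab by (auto simp: Z_def)
      then have "\<kappa> y = \<theta> y" if "y \<in> Z \<or> y \<le> L \<or> U \<le> y" for y
        using that \<eta>(3)[of y] \<kappa>(3)[of y] ab(4)[of y] by force
      moreover have "sgn_match \<kappa> p q y" if "a' \<in> insert a T" "consec a' b'" "a' < y" "y < b'" for a' b' y
      proof (cases "a < y \<and> y < b")
        case True
        then show ?thesis using \<kappa>(4) by blast
      next
        case False
        have "a' \<noteq> a"
        proof
          assume "a' = a"
          then have "b' = b" using b that(2) unfolding consec_def by force
          then show False using False that \<open>a' = a\<close> by blast
        qed
        then have "sgn_match \<eta> p q y" using that \<eta>(4) by blast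
        then show ?thesis using False \<kappa>(3)[of y] by (auto simp: sgn_match_def)
      qed
      ultimately show ?thesis using \<kappa>(1,2) by blast
    qed
  qed
  from this[OF finZ] obtain \<eta> where \<eta>: "incbij \<eta>" "\<And>f g y. (f, g) \<in> F \<Longrightarrow> sgn_match \<eta> f g y"
      "\<And>y. y \<in> Z \<or> y \<le> L \<or> U \<le> y \<Longrightarrow> \<eta> y = \<theta> y"
      "\<And>a b y. a \<in> Z \<Longrightarrow> consec a b \<Longrightarrow> a < y \<Longrightarrow> y < b \<Longrightarrow> sgn_match \<eta> p q y"
    by blast
  have "sgn_match \<eta> p q y" for y
  proof (cases "y \<in> Z \<or> y \<le> L \<or> U \<le> y")
    case True
    then show ?thesis using \<eta>(3) top bot Zm by (auto simp: sgn_match_def)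
  next
    case False
    define a where "a = Max {z\<in>Z. z < y}"
    define b where "b = Min {z\<in>Z. z > y}"
    have "L \<in> {z\<in>Z. z < y}" "U \<in> {z\<in>Z. z > y}" using False by (auto simp: Z_def)
    then have a: "a \<in> {z\<in>Z. z < y}" and b: "b \<in> {z\<in>Z. z > y}"
      unfolding a_def b_def using finZ by (intro Max_in Min_in; force)+
    have "z \<le> a \<or> b \<le> z" if "z \<in> Z" for z
    proof (cases "z < y")
      case True
      then show ?thesis unfolding a_def using finZ that by (auto intro!: disjI1 Max_ge)
    next
      case False2: False
      then have "z > y" using that False by (cases "z = y") auto
      then show ?thesis unfolding b_def using finZ that by (auto intro!: disjI2 Min_le)
    qed
    then have "consec a b" using a b by (auto simp: consec_def)
    then show ?thesis using \<eta>(4)[of a b y] a b by blast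
  qed
  then show thesis using \<eta>(1,2) that by blast
qed

section \<open>Tarski--Seidenberg\<close>

inductive pfun :: "nat set \<Rightarrow> ((nat \<Rightarrow> real) \<Rightarrow> real) \<Rightarrow> bool" for V where
  const: "pfun V (\<lambda>x. c)"
| var: "i \<in> V \<Longrightarrow> pfun V (\<lambda>x. x i)"
| add: "pfun V p \<Longrightarrow> pfun V q \<Longrightarrow> pfun V (\<lambda>x. p x + q x)"
| mult: "pfun V p \<Longrightarrow> pfun V q \<Longrightarrow> pfun V (\<lambda>x. p x * q x)"

lemma pfun_mono: "pfun V p \<Longrightarrow> V \<subseteq> W \<Longrightarrow> pfun W p"
  by (induction rule: pfun.induct) (auto intro: pfun.intros)

lemma pfun_cong: "pfun V p \<Longrightarrow> (\<And>i. i \<in> V \<Longrightarrow> x i = y i) \<Longrightarrow> p x = p y"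
  by (induction rule: pfun.induct) auto

lemma pfun_uminus: "pfun V p \<Longrightarrow> pfun V (\<lambda>x. - p x)"
  using pfun.mult[OF pfun.const[of V "-1"], of p] by simp

lemma pfun_diff: "pfun V p \<Longrightarrow> pfun V q \<Longrightarrow> pfun V (\<lambda>x. p x - q x)"
  using pfun.add[OF _ pfun_uminus, of V p q] by simp

lemma pfun_power: "pfun V p \<Longrightarrow> pfun V (\<lambda>x. p x ^ k)"
  by (induction k) (auto intro: pfun.intros)

lemma pfun_sum: "(\<And>i. i \<in> I \<Longrightarrow> pfun V (p i)) \<Longrightarrow> pfun V (\<lambda>x. \<Sum>i\<in>I. p i x)"
  by (induction I rule: infinite_finite_induct) (auto intro: pfun.intros)

lemma pfun_prod: "(\<And>i. i \<in> I \<Longrightarrow> pfun V (p i)) \<Longrightarrow> pfun V (\<lambda>x. \<Prod>i\<in>I. p i x)"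
  by (induction I rule: infinite_finite_induct) (auto intro: pfun.intros)

lemma pfun_continuous: "pfun V p \<Longrightarrow> continuous_on S p"
  by (induction rule: pfun.induct)
    (auto intro!: continuous_intros intro: continuous_on_subset[OF continuous_on_product_coordinates])

text \<open>\<open>P x\<close> is a polynomial in one distinguished variable; \<open>x\<close> holds the remaining variables.\<close>

definition pfun_poly :: "nat set \<Rightarrow> nat \<Rightarrow> ((nat \<Rightarrow> real) \<Rightarrow> real poly) \<Rightarrow> bool" where
  "pfun_poly V d P \<longleftrightarrow> (\<forall>j. pfun V (\<lambda>x. coeff (P x) j)) \<and> (\<forall>x. degree (P x) \<le> d)"

lemma pfun_poly_mono: "pfun_poly V d P \<Longrightarrow> d \<le> e \<Longrightarrow> pfun_poly V e P"
  unfolding pfun_poly_def using order_trans by blast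

lemma pfun_poly_add: "pfun_poly V d P \<Longrightarrow> pfun_poly V d Q \<Longrightarrow> pfun_poly V d (\<lambda>x. P x + Q x)"
  by (auto simp: pfun_poly_def intro: pfun.intros degree_add_le)

lemma pfun_poly_mult: "pfun_poly V d P \<Longrightarrow> pfun_poly V e Q \<Longrightarrow> pfun_poly V (d + e) (\<lambda>x. P x * Q x)"
  unfolding pfun_poly_def coeff_mult
  by (intro conjI allI pfun_sum pfun.mult order_trans[OF degree_mult_le] add_mono) auto

lemma pfun_insert_poly:
  assumes "pfun (insert a V) p"
  obtains d P where "pfun_poly V d P" "\<And>x. p x = poly (P x) (x a)"
  using assms
proof (induction arbitrary: thesis rule: pfun.induct)
  case (const c)
  have "pfun_poly V 0 (\<lambda>x. [:c:])" unfolding pfun_poly_def by (simp add: pfun.const)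
  then show ?case by (rule const) simp
next
  case (var i)
  show ?case
  proof (cases "i = a")
    case True
    have "pfun_poly V 1 (\<lambda>x. [:0, 1:])" unfolding pfun_poly_def by (simp add: pfun.const)
    then show ?thesis by (rule var(2)) (simp add: True)
  next
    case False
    then have i: "pfun V (\<lambda>x. x i)" using var(1) by (intro pfun.var) auto
    have "pfun V (\<lambda>x. coeff [:x i:] j)" for j
      by (cases j) (simp_all add: i pfun.const)
    then have "pfun_poly V 0 (\<lambda>x. [:x i:])" unfolding pfun_poly_def by simp
    then show ?thesis by (rule var(2)) simp
  qed
next
  case (add p q)
  obtain d P where P: "pfun_poly V d P" "\<And>x. p x = poly (P x) (x a)" using add.IH(1) by blast
  obtain e Q where Q: "pfun_poly V e Q" "\<And>x. q x = poly (Q x) (x a)" using add.IH(2) by blast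
  have "pfun_poly V (max d e) (\<lambda>x. P x + Q x)"
    by (intro pfun_poly_add pfun_poly_mono[OF P(1)] pfun_poly_mono[OF Q(1)]) auto
  then show ?case by (rule add.prems) (simp add: P Q)
next
  case (mult p q)
  obtain d P where P: "pfun_poly V d P" "\<And>x. p x = poly (P x) (x a)" using mult.IH(1) by blast
  obtain e Q where Q: "pfun_poly V e Q" "\<And>x. q x = poly (Q x) (x a)" using mult.IH(2) by blast
  show ?case by (rule mult.prems[OF pfun_poly_mult[OF P(1) Q(1)]]) (simp add: P Q)
qed

lemma pfun_poly_pderiv: "pfun_poly V (Suc d) P \<Longrightarrow> pfun_poly V d (\<lambda>x. pderiv (P x))"
proof -
  assume "pfun_poly V (Suc d) P"
  then have P: "pfun V (\<lambda>x. coeff (P x) j)" "degree (P x) \<le> Suc d" for j x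
    by (auto simp: pfun_poly_def)
  have "degree (pderiv (P x)) \<le> d" for x
    using P(2)[of x] by (simp add: degree_pderiv)
  moreover have "pfun V (\<lambda>x. coeff (pderiv (P x)) j)" for j
    unfolding coeff_pderiv by (intro pfun.mult pfun.const P)
  ultimately show ?thesis by (simp add: pfun_poly_def)
qed

lemma degree_poly_cutoff: "degree (poly_cutoff (Suc e) p) \<le> e"
  by (rule degree_le) (auto simp: coeff_poly_cutoff)

lemma pfun_poly_cutoff: "pfun_poly V d P \<Longrightarrow> pfun_poly V e (\<lambda>x. poly_cutoff (Suc e) (P x))"
proof -
  assume P: "pfun_poly V d P"
  have "pfun V (\<lambda>x. coeff (poly_cutoff (Suc e) (P x)) j)" for j
    unfolding coeff_poly_cutoff using P
    by (cases "j < Suc e") (auto simp: pfun_poly_def intro: pfun.const)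
  then show ?thesis by (simp add: pfun_poly_def degree_poly_cutoff)
qed

lemma poly_cutoff_eq: "degree p \<le> e \<Longrightarrow> poly_cutoff (Suc e) p = p"
  by (auto simp: poly_eq_iff coeff_poly_cutoff coeff_eq_0)

text \<open>A pseudo-remainder in which the leading coefficient of the divisor enters with an even power,
  so that it has the sign of the dividend at the roots of the divisor.\<close>

lemma pfun_poly_remainder:
  assumes "pfun_poly V d P" "pfun_poly V (Suc e) B"
  obtains R where "pfun_poly V e R"
    "\<And>x y. coeff (B x) (Suc e) \<noteq> 0 \<Longrightarrow> poly (B x) y = 0 \<Longrightarrow> sgn (poly (R x) y) = sgn (poly (P x) y)"
  using assms(1)
proof (induction d arbitrary: P thesis)
  case 0
  show ?case using 0 pfun_poly_mono[of V 0 P e] by blast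
next
  case (Suc d)
  show ?case
  proof (cases "Suc d \<le> e")
    case True
    show ?thesis using Suc.prems pfun_poly_mono[OF _ True] by blast
  next
    case False
    define a where "a x = coeff (P x) (Suc d)" for x
    define b where "b x = coeff (B x) (Suc e)" for x
    \<comment> \<open>One division step: here \<open>e \<le> d\<close>, and the shift by
      \<open>d - e\<close> moves the top coefficient of \<open>B\<close> to degree
      \<open>Suc d\<close>, where \<open>b x ^ 2 * a x\<close> cancels against
      \<open>a x * b x * b x\<close>.\<close>
    define P' where "P' x = smult (b x ^ 2) (P x) - monom (a x * b x) (d - e) * B x" for x
    have ab: "pfun V a" "pfun V b"
      using Suc.prems(2) assms(2) unfolding pfun_poly_def a_def[abs_def] b_def[abs_def] by auto
    have c: "coeff (P' x) j = b x ^ 2 * coeff (P x) j - (if j < d - e then 0 else a x * b x * coeff (B x) (j - (d - e)))" for x j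
      by (simp add: P'_def coeff_monom_mult)
    have "pfun V (\<lambda>x. coeff (P' x) j)" for j
      unfolding c using Suc.prems(2) assms(2) ab
      by (cases "j < d - e")
        (simp_all add: pfun_poly_def pfun_diff pfun.mult pfun_power pfun.const)
    moreover have "degree (P' x) \<le> d" for x
    proof (rule degree_le, intro allI impI)
      fix j assume j: "d < j"
      show "coeff (P' x) j = 0"
      proof (cases "j = Suc d")
        case True
        then have "j - (d - e) = Suc e" using False by simp
        then show ?thesis unfolding c True[symmetric] a_def b_def using True
          by (auto simp: power2_eq_square)
      next
        case jn: False
        have "degree (P x) < j" "degree (B x) < j - (d - e)"
          using jn j False Suc.prems(2) assms(2)
          by (auto simp: pfun_poly_def intro: le_less_trans[of _ "Suc d"] le_less_trans[of _ "Suc e"])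
        then show ?thesis unfolding c by (simp add: coeff_eq_0)
      qed
    qed
    ultimately have "pfun_poly V d P'" by (simp add: pfun_poly_def)
    then obtain R where R: "pfun_poly V e R"
      "\<And>x y. coeff (B x) (Suc e) \<noteq> 0 \<Longrightarrow> poly (B x) y = 0 \<Longrightarrow> sgn (poly (R x) y) = sgn (poly (P' x) y)"
      using Suc.IH by blast
    show ?thesis
    proof (rule Suc.prems(1)[OF R(1)])
      fix x y assume *: "coeff (B x) (Suc e) \<noteq> 0" "poly (B x) y = 0"
      then have "sgn (poly (R x) y) = sgn (b x ^ 2 * poly (P x) y)"
        using R(2)[OF *] by (simp add: P'_def)
      also have "\<dots> = sgn (poly (P x) y)"
        using *(1) by (subst sgn_mult, subst sgn_pos) (auto simp: b_def)
      finally show "sgn (poly (R x) y) = sgn (poly (P x) y)" .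
    qed
  qed
qed

text \<open>The remainders by all truncations of \<open>B\<close> are needed, because the actual degree of \<open>B x\<close> depends
  on \<open>x\<close>.\<close>

lemma sgn_match_at_root:
  assumes P: "pfun_poly V d P"
    and R: "\<And>e. e < D \<Longrightarrow> pfun_poly V e (R e) \<and> (\<forall>x y. coeff (poly_cutoff (Suc (Suc e)) (B x)) (Suc e) \<noteq> 0 \<longrightarrow>
       poly (poly_cutoff (Suc (Suc e)) (B x)) y = 0 \<longrightarrow> sgn (poly (R e x) y) = sgn (poly (P x) y))"
    and deg: "degree (B x) \<le> D"
    and cf: "\<And>j. j \<le> D \<Longrightarrow> sgn (coeff (B x) j) = sgn (coeff (B x') j)" "degree (B x') \<le> D"
    and m: "\<And>e. e < D \<Longrightarrow> sgn_match \<theta> (R e x) (R e x') y" "sgn_match \<theta> (B x) (B x') y"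
    and nz: "B x \<noteq> 0" and root: "poly (B x) y = 0"
  shows "sgn_match \<theta> (P x) (P x') y"
proof -
  \<comment> \<open>The same coefficients vanish over \<open>x\<close> and \<open>x'\<close>, so
    both divisors have the same degree and one remainder \<open>R e\<close> serves both
    points.\<close>
  have cz: "coeff (B x) j = 0 \<longleftrightarrow> coeff (B x') j = 0" for j
  proof (cases "j \<le> D")
    case True
    then show ?thesis using cf(1) by (metis sgn_zero_iff)
  next
    case False
    then show ?thesis using deg cf(2) by (simp add: coeff_eq_0)
  qed
  have degeq: "degree (B x') = degree (B x)"
    by (meson cz antisym coeff_eq_0 degree_le leading_coeff_0_iff linorder_not_less nz le_degree)
  have "degree (B x) \<noteq> 0"
  proof
    assume "degree (B x) = 0"
    then obtain c where "B x = [:c:]" by (rule degree_eq_zeroE)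
    then show False using nz root by simp
  qed
  then obtain e where e: "degree (B x) = Suc e" by (cases "degree (B x)") auto
  then have eD: "e < D" using deg by simp
  have cut: "poly_cutoff (Suc (Suc e)) (B x) = B x" "poly_cutoff (Suc (Suc e)) (B x') = B x'"
    using e degeq by (auto intro: poly_cutoff_eq)
  have lc: "coeff (B x) (Suc e) \<noteq> 0" "coeff (B x') (Suc e) \<noteq> 0"
    using e degeq nz by (metis leading_coeff_0_iff, metis cz leading_coeff_0_iff)
  have root': "poly (B x') (\<theta> y) = 0" using sgn_match_zero[OF m(2)] root by simp
  have "sgn (poly (P x) y) = sgn (poly (R e x) y)"
    using R[OF eD] lc(1) root cut(1) by metis
  moreover have "sgn (poly (P x') (\<theta> y)) = sgn (poly (R e x') (\<theta> y))"
    using R[OF eD] lc(2) root' cut(2) by metis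
  ultimately show ?thesis using m(1)[OF eD] by (simp add: sgn_match_def)
qed

section \<open>Sign tables over a parameter\<close>

definition sgn_eq :: "((nat \<Rightarrow> real) \<Rightarrow> real) set \<Rightarrow> (nat \<Rightarrow> real) \<Rightarrow> (nat \<Rightarrow> real) \<Rightarrow> bool" where
  "sgn_eq Q x x' \<longleftrightarrow> (\<forall>q\<in>Q. sgn (q x) = sgn (q x'))"

text \<open>Equality of sign tables in the sense of Cohen and Hormander, without recording the
  tables: a single \<open>\<theta>\<close> serves the whole family, so it aligns the roots of all
  members and the gaps between them simultaneously.\<close>

definition sgn_controlled :: "nat set \<Rightarrow> ((nat \<Rightarrow> real) \<Rightarrow> real poly) set \<Rightarrow> bool" where
  "sgn_controlled V F \<longleftrightarrow> (\<exists>Q. finite Q \<and> (\<forall>q\<in>Q. pfun V q) \<and>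
     (\<forall>x x'. sgn_eq Q x x' \<longrightarrow> (\<exists>\<theta>. incbij \<theta> \<and> (\<forall>P\<in>F. \<forall>y. sgn_match \<theta> (P x) (P x') y))))"

text \<open>What matters about \<open>P\<close> is visible in polynomials with a smaller degree
  bound. If its top coefficient vanishes at \<open>x\<close>, it equals its truncation there;
  otherwise remainders give its signs at the roots of the other members, and its derivative leaves
  it at most one root per gap.\<close>

lemma sgn_controlled_insert:
  assumes fin: "finite F" and F: "\<And>B. B \<in> F \<Longrightarrow> pfun_poly V (Suc d) B"
    and P: "pfun_poly V (Suc d) P"
    and R: "\<And>B e. B \<in> insert (\<lambda>x. pderiv (P x)) F \<Longrightarrow> e \<le> d \<Longrightarrow> pfun_poly V e (R B e) \<and>
      (\<forall>x y. coeff (poly_cutoff (Suc (Suc e)) (B x)) (Suc e) \<noteq> 0 \<longrightarrow>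
       poly (poly_cutoff (Suc (Suc e)) (B x)) y = 0 \<longrightarrow> sgn (poly (R B e x) y) = sgn (poly (P x) y))"
    and IH: "sgn_controlled V (F \<union> {\<lambda>x. pderiv (P x), \<lambda>x. poly_cutoff (Suc d) (P x)} \<union>
       (\<lambda>(B, e). R B e) ` (insert (\<lambda>x. pderiv (P x)) F \<times> {..d}))"
  shows "sgn_controlled V (insert P F)"
proof -
  define F' where "F' = insert (\<lambda>x. pderiv (P x)) F"
  have F': "pfun_poly V (Suc d) B" if "B \<in> F'" for B
    using that F pfun_poly_pderiv[OF P] pfun_poly_mono[of V d _ "Suc d"] by (auto simp: F'_def)
  obtain Q where Q: "finite Q" "\<And>q. q \<in> Q \<Longrightarrow> pfun V q"
    "\<And>x x'. sgn_eq Q x x' \<Longrightarrow> \<exists>\<theta>. incbij \<theta> \<and> (\<forall>P\<in>F' \<union> {\<lambda>x. poly_cutoff (Suc d) (P x)} \<union>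
       (\<lambda>(B, e). R B e) ` (F' \<times> {..d}). \<forall>y. sgn_match \<theta> (P x) (P x') y)"
    using IH unfolding sgn_controlled_def F'_def by (auto simp: insert_commute Un_insert_right)
  \<comment> \<open>With all coefficients among the test functions, \<open>x\<close> and
    \<open>x'\<close> agree on the actual degrees and on the signs of the leading
    coefficients.\<close>
  define Q' where "Q' = Q \<union> (\<lambda>(B, j) x. coeff (B x) j) ` (insert P F' \<times> {..Suc d})"
  have "\<exists>\<theta>. incbij \<theta> \<and> (\<forall>B\<in>insert P F. \<forall>y. sgn_match \<theta> (B x) (B x') y)" if xx: "sgn_eq Q' x x'" for x x'
  proof -
    have "sgn_eq Q x x'" using xx by (auto simp: Q'_def sgn_eq_def)
    then obtain \<theta> where \<theta>: "incbij \<theta>"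
      "\<And>B y. B \<in> F' \<Longrightarrow> sgn_match \<theta> (B x) (B x') y"
      "\<And>y. sgn_match \<theta> (poly_cutoff (Suc d) (P x)) (poly_cutoff (Suc d) (P x')) y"
      "\<And>B e y. B \<in> F' \<Longrightarrow> e \<le> d \<Longrightarrow> sgn_match \<theta> (R B e x) (R B e x') y"
      using Q(3) by (fastforce simp: image_iff)
    have cf: "sgn (coeff (B x) j) = sgn (coeff (B x') j)" if "B \<in> insert P F'" "j \<le> Suc d" for B j
    proof -
      have "(\<lambda>x. coeff (B x) j) \<in> Q'"
        unfolding Q'_def using that by (intro UnI2 image_eqI[of _ _ "(B, j)"]) auto
      from bspec[OF xx[unfolded sgn_eq_def] this] show ?thesis .
    qed
    have dg: "degree (B z) \<le> Suc d" if "B \<in> insert P F'" for B z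
      using that F' P by (auto simp: pfun_poly_def)
    show ?thesis
    proof (cases "coeff (P x) (Suc d) = 0")
      case True
      then have "coeff (P x') (Suc d) = 0" using cf[of P "Suc d"] by (auto simp: sgn_zero_iff)
      then have "degree (P x) \<le> d" "degree (P x') \<le> d"
        using True dg[of P x] dg[of P x'] by (metis insertI1 le_SucE leading_coeff_0_iff degree_0 le0)+
      then show ?thesis using \<theta>(1-3) by (auto simp: poly_cutoff_eq F'_def)
    next
      case False
      then have "coeff (P x') (Suc d) \<noteq> 0" using cf[of P "Suc d"] by (auto simp: sgn_zero_iff)
      then have dP: "degree (P x) = Suc d" "degree (P x') = Suc d"
        using False dg[of P x] dg[of P x'] by (auto intro: antisym le_degree)
      define G where "G = (\<lambda>B. (B x, B x')) ` F'"
      have roots: "sgn_match \<theta> (P x) (P x') y" if fg: "(f, g) \<in> G" "f \<noteq> 0" "poly f y = 0" for f g y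
      proof -
        obtain B where B: "B \<in> F'" "f = B x" "g = B x'" using fg by (auto simp: G_def)
        show ?thesis
        proof (rule sgn_match_at_root[where R = "R B" and B = B and D = "Suc d" and V = V])
          show "pfun_poly V (Suc d) P" by (rule P)
          show "pfun_poly V e (R B e) \<and> (\<forall>x y. coeff (poly_cutoff (Suc (Suc e)) (B x)) (Suc e) \<noteq> 0 \<longrightarrow>
            poly (poly_cutoff (Suc (Suc e)) (B x)) y = 0 \<longrightarrow> sgn (poly (R B e x) y) = sgn (poly (P x) y))"
            if "e < Suc d" for e using R[of B e] B that by (simp add: F'_def)
        qed (use B fg dg cf \<theta> in auto)
      qed
      have "finite G" using fin by (simp add: G_def F'_def)
      moreover have "sgn_match \<theta> f g y" if "(f, g) \<in> G" for f g y
        using that \<theta>(2) by (auto simp: G_def)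
      moreover have "(pderiv (P x), pderiv (P x')) \<in> G" by (auto simp: G_def F'_def)
      moreover have "degree (P x) = degree (P x')" "degree (P x) > 0"
        "sgn (lead_coeff (P x)) = sgn (lead_coeff (P x'))"
        using dP cf[of P "Suc d"] by auto
      ultimately obtain \<eta> where "incbij \<eta>"
        "\<And>f g y. (f, g) \<in> insert (P x, P x') G \<Longrightarrow> sgn_match \<eta> f g y"
        using sgn_match_insert[of G \<theta> "P x" "P x'"] \<theta>(1) roots by metis
      then show ?thesis by (auto simp: G_def F'_def)
    qed
  qed
  moreover have "finite Q'" using Q(1) fin by (auto simp: Q'_def F'_def)
  moreover have "pfun V q" if "q \<in> Q'" for q
    using that Q(2) F' P by (auto simp: Q'_def pfun_poly_def)
  ultimately show ?thesis unfolding sgn_controlled_def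
    by (intro exI[of _ Q'] conjI ballI allI impI)
qed

text \<open>Double induction, because removing one polynomial of top degree brings in many of lower
  degree: its truncation, its derivative and the remainders. The outer induction is on the degree
  bound, the inner one on the set \<open>T\<close> of members allowed top degree, with the
  low-degree rest \<open>S\<close> arbitrary.\<close>

lemma sgn_controlled_finite:
  assumes "finite F" "\<And>P. P \<in> F \<Longrightarrow> pfun_poly V d P"
  shows "sgn_controlled V F"
  using assms
proof (induction d arbitrary: F)
  case 0
  define Q where "Q = (\<lambda>P x. coeff (P x) 0) ` F"
  have "poly (P x) y = coeff (P x) 0" if "P \<in> F" for P x y
  proof -
    have "degree (P x) = 0" using 0 that by (auto simp: pfun_poly_def)
    then show ?thesis by (metis degree_eq_zeroE coeff_pCons_0 poly_pCons poly_0 mult_zero_right add.right_neutral)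
  qed
  then have "\<forall>P\<in>F. \<forall>y. sgn_match (\<lambda>y. y) (P x) (P x') y" if "sgn_eq Q x x'" for x x'
    using that by (auto simp: sgn_eq_def Q_def sgn_match_def)
  moreover have "finite Q" "\<forall>q\<in>Q. pfun V q" using 0 by (auto simp: Q_def pfun_poly_def)
  ultimately show ?case unfolding sgn_controlled_def
    by (intro exI[of _ Q] conjI allI impI exI[of _ "\<lambda>y. y"] incbij_id) auto
next
  case (Suc d)
  have "sgn_controlled V (T \<union> S)"
    if "finite T" "finite S" "\<forall>P\<in>T. pfun_poly V (Suc d) P" "\<forall>P\<in>S. pfun_poly V d P" for T S
    using that
  proof (induction T arbitrary: S rule: finite_induct)
    case empty
    then show ?case using Suc.IH by simp
  next
    case (insert P T)
    then have P: "pfun_poly V (Suc d) P" by simp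
    have "\<exists>R. \<forall>B e. B \<in> insert (\<lambda>x. pderiv (P x)) (T \<union> S) \<and> e \<le> d \<longrightarrow> pfun_poly V e (R B e) \<and>
      (\<forall>x y. coeff (poly_cutoff (Suc (Suc e)) (B x)) (Suc e) \<noteq> 0 \<longrightarrow>
       poly (poly_cutoff (Suc (Suc e)) (B x)) y = 0 \<longrightarrow> sgn (poly (R B e x) y) = sgn (poly (P x) y))"
    proof -
      have "\<exists>R. pfun_poly V e R \<and>
      (\<forall>x y. coeff (poly_cutoff (Suc (Suc e)) (B x)) (Suc e) \<noteq> 0 \<longrightarrow>
       poly (poly_cutoff (Suc (Suc e)) (B x)) y = 0 \<longrightarrow> sgn (poly (R x) y) = sgn (poly (P x) y))"
        if "B \<in> insert (\<lambda>x. pderiv (P x)) (T \<union> S)" for B e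
      proof -
        have "\<exists>k. pfun_poly V k B" using that insert.prems pfun_poly_pderiv[OF P] by auto
        then have "pfun_poly V (Suc e) (\<lambda>x. poly_cutoff (Suc (Suc e)) (B x))"
          using pfun_poly_cutoff by blast
        then show ?thesis using pfun_poly_remainder[OF P] by metis
      qed
      then show ?thesis by metis
    qed
    then obtain R where R: "\<And>B e. B \<in> insert (\<lambda>x. pderiv (P x)) (T \<union> S) \<Longrightarrow> e \<le> d \<Longrightarrow> pfun_poly V e (R B e) \<and>
      (\<forall>x y. coeff (poly_cutoff (Suc (Suc e)) (B x)) (Suc e) \<noteq> 0 \<longrightarrow>
       poly (poly_cutoff (Suc (Suc e)) (B x)) y = 0 \<longrightarrow> sgn (poly (R B e x) y) = sgn (poly (P x) y))"
      by blast
    define S' where "S' = S \<union> {\<lambda>x. pderiv (P x), \<lambda>x. poly_cutoff (Suc d) (P x)} \<union>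
       (\<lambda>(B, e). R B e) ` (insert (\<lambda>x. pderiv (P x)) (T \<union> S) \<times> {..d})"
    have "finite S'" using insert.prems insert.hyps by (auto simp: S'_def)
    moreover have "pfun_poly V d B" if B: "B \<in> S'" for B
    proof -
      have "pfun_poly V d (R B e)" if "B \<in> insert (\<lambda>x. pderiv (P x)) (T \<union> S)" "e \<le> d" for B e
        using R[OF that] that(2) pfun_poly_mono by blast
      then have "\<forall>B\<in>(\<lambda>(B, e). R B e) ` (insert (\<lambda>x. pderiv (P x)) (T \<union> S) \<times> {..d}). pfun_poly V d B"
        by auto
      then show ?thesis
        using B insert.prems(3) pfun_poly_pderiv[OF P] pfun_poly_cutoff[OF P, of d]
        unfolding S'_def by blast
    qed
    ultimately have "sgn_controlled V (T \<union> S')"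
      using insert.IH insert.prems by blast
    moreover have "T \<union> S' = (T \<union> S) \<union> {\<lambda>x. pderiv (P x), \<lambda>x. poly_cutoff (Suc d) (P x)} \<union>
       (\<lambda>(B, e). R B e) ` (insert (\<lambda>x. pderiv (P x)) (T \<union> S) \<times> {..d})"
      unfolding S'_def by blast
    moreover have "pfun_poly V (Suc d) B" if "B \<in> T \<union> S" for B
      using that insert.prems pfun_poly_mono[of V d B "Suc d"] by auto
    ultimately have "sgn_controlled V (insert P (T \<union> S))"
      using sgn_controlled_insert[of "T \<union> S" V d P R] insert.hyps insert.prems P R by auto
    then show ?case by simp
  qed
  from this[of F "{}"] show ?case using Suc.prems by simp
qed

text \<open>Semi-algebraicity in semantic form: the set is a union of sign classes of finitely many
  polynomials. Boolean operations then need no normal form.\<close>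

definition sgn_determined :: "nat set \<Rightarrow> (nat \<Rightarrow> real) set \<Rightarrow> bool" where
  "sgn_determined V A \<longleftrightarrow> (\<exists>Q. finite Q \<and> (\<forall>q\<in>Q. pfun V q) \<and>
     (\<forall>x x'. sgn_eq Q x x' \<longrightarrow> (x \<in> A \<longleftrightarrow> x' \<in> A)))"

lemma sgn_eq_sym: "sgn_eq Q x x' \<longleftrightarrow> sgn_eq Q x' x"
  by (auto simp: sgn_eq_def)

lemma sgn_determinedI:
  assumes "finite Q" "\<And>q. q \<in> Q \<Longrightarrow> pfun V q" "\<And>x x'. sgn_eq Q x x' \<Longrightarrow> x \<in> A \<Longrightarrow> x' \<in> A"
  shows "sgn_determined V A"
proof -
  have "x \<in> A \<longleftrightarrow> x' \<in> A" if "sgn_eq Q x x'" for x x'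
    using assms(3)[OF that] assms(3)[of x' x] that sgn_eq_sym by metis
  then show ?thesis using assms(1,2) unfolding sgn_determined_def
    by (intro exI[of _ Q] conjI ballI allI impI)
qed

lemma sgn_determinedE:
  assumes "sgn_determined V A"
  obtains Q where "finite Q" "\<And>q. q \<in> Q \<Longrightarrow> pfun V q" "\<And>x x'. sgn_eq Q x x' \<Longrightarrow> x \<in> A \<longleftrightarrow> x' \<in> A"
  using assms unfolding sgn_determined_def by (elim exE conjE) metis

lemma sgn_determined_mono: "sgn_determined V A \<Longrightarrow> V \<subseteq> W \<Longrightarrow> sgn_determined W A"
  by (elim sgn_determinedE, rule sgn_determinedI) (auto intro: pfun_mono)

lemma sgn_determined_zero: "pfun V p \<Longrightarrow> sgn_determined V {x. p x = 0}"
  by (rule sgn_determinedI[of "{p}"]) (simp_all add: sgn_eq_def sgn_if split: if_splits)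

lemma sgn_determined_pos: "pfun V p \<Longrightarrow> sgn_determined V {x. p x > 0}"
  by (rule sgn_determinedI[of "{p}"]) (simp_all add: sgn_eq_def sgn_if split: if_splits)

lemma sgn_determined_Compl: "sgn_determined V A \<Longrightarrow> sgn_determined V (- A)"
  by (elim sgn_determinedE, rule sgn_determinedI) auto

lemma sgn_determined_Un:
  assumes "sgn_determined V A" "sgn_determined V B"
  shows "sgn_determined V (A \<union> B)"
proof -
  obtain Q where Q: "finite Q" "\<And>q. q \<in> Q \<Longrightarrow> pfun V q" "\<And>x x'. sgn_eq Q x x' \<Longrightarrow> x \<in> A \<longleftrightarrow> x' \<in> A"
    using sgn_determinedE[OF assms(1)] by metis
  obtain R where R: "finite R" "\<And>q. q \<in> R \<Longrightarrow> pfun V q" "\<And>x x'. sgn_eq R x x' \<Longrightarrow> x \<in> B \<longleftrightarrow> x' \<in> B"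
    using sgn_determinedE[OF assms(2)] by metis
  have "x \<in> A \<union> B \<longleftrightarrow> x' \<in> A \<union> B" if "sgn_eq (Q \<union> R) x x'" for x x'
  proof -
    have "sgn_eq Q x x'" "sgn_eq R x x'" using that by (auto simp: sgn_eq_def)
    then show ?thesis using Q(3) R(3) by blast
  qed
  then show ?thesis using Q(1,2) R(1,2) by (intro sgn_determinedI[of "Q \<union> R"]) auto
qed

lemma sgn_determined_Int:
  assumes "sgn_determined V A" "sgn_determined V B"
  shows "sgn_determined V (A \<inter> B)"
  using sgn_determined_Compl[OF sgn_determined_Un[OF sgn_determined_Compl[OF assms(1)] sgn_determined_Compl[OF assms(2)]]]
  by simp

lemma sgn_determined_INT:
  assumes "finite I" "\<And>i. i \<in> I \<Longrightarrow> sgn_determined V (A i)"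
  shows "sgn_determined V (\<Inter>i\<in>I. A i)"
  using assms
proof (induction I)
  case empty
  show ?case by (rule sgn_determinedI[of "{}"]) auto
next
  case (insert i I)
  then show ?case by (auto intro: sgn_determined_Int)
qed

text \<open>The projection step of Tarski--Seidenberg: if \<open>y\<close> is a witness over
  \<open>x\<close> and \<open>x'\<close> has the same signs, then \<open>\<theta> y\<close> is a
  witness over \<open>x'\<close>.\<close>

lemma sgn_determined_project:
  assumes "sgn_determined (insert a V) A" "a \<notin> V"
  shows "sgn_determined V {x. \<exists>y. x(a := y) \<in> A}"
proof -
  obtain Q where Q: "finite Q" "\<And>q. q \<in> Q \<Longrightarrow> pfun (insert a V) q"
    "\<And>x x'. sgn_eq Q x x' \<Longrightarrow> x \<in> A \<longleftrightarrow> x' \<in> A"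
    using sgn_determinedE[OF assms(1)] by metis
  have "\<exists>d P. pfun_poly V d P \<and> (\<forall>x. q x = poly (P x) (x a))" if "q \<in> Q" for q
    using pfun_insert_poly[OF Q(2)[OF that]] by metis
  then obtain d P where P: "\<And>q. q \<in> Q \<Longrightarrow> pfun_poly V (d q) (P q)" "\<And>q x. q \<in> Q \<Longrightarrow> q x = poly (P q x) (x a)"
    by metis
  have "pfun_poly V (Max (d ` Q)) (P q)" if "q \<in> Q" for q
    using P(1)[OF that] that Q(1) by (auto intro: pfun_poly_mono)
  then have "sgn_controlled V (P ` Q)"
    using Q(1) by (intro sgn_controlled_finite) auto
  then obtain R where R: "finite R" "\<And>r. r \<in> R \<Longrightarrow> pfun V r"
    "\<And>x x'. sgn_eq R x x' \<Longrightarrow> \<exists>\<theta>. incbij \<theta> \<and> (\<forall>P\<in>P ` Q. \<forall>y. sgn_match \<theta> (P x) (P x') y)"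
    unfolding sgn_controlled_def by blast
  \<comment> \<open>The coefficients use variables from \<open>V\<close> only, and \<open>a\<close>
    is not among them.\<close>
  have upd: "P q (x(a := y)) = P q x" if "q \<in> Q" for q x y
  proof -
    have "coeff (P q (x(a := y))) j = coeff (P q x) j" for j
    proof (rule pfun_cong[of V "\<lambda>x. coeff (P q x) j"])
      show "pfun V (\<lambda>x. coeff (P q x) j)" using P(1)[OF that] by (simp add: pfun_poly_def)
    qed (use assms(2) in auto)
    then show ?thesis by (simp add: poly_eq_iff)
  qed
  have "x' \<in> {x. \<exists>y. x(a := y) \<in> A}"
    if eq: "sgn_eq R x x'" and mem: "x \<in> {x. \<exists>y. x(a := y) \<in> A}" for x x'
  proof -
    obtain y where y: "x(a := y) \<in> A" using mem by blast
    obtain \<theta> where "\<And>q y. q \<in> Q \<Longrightarrow> sgn_match \<theta> (P q x) (P q x') y"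
      using R(3)[OF eq] by auto
    then have "sgn_eq Q (x(a := y)) (x'(a := \<theta> y))"
      unfolding sgn_eq_def sgn_match_def using P(2) upd by (metis fun_upd_same)
    then show ?thesis using Q(3) y by blast
  qed
  then show ?thesis using R(1,2) by (intro sgn_determinedI[of R])
qed

lemma sgn_determined_project_finite:
  assumes "finite W" "sgn_determined (V \<union> W) A" "V \<inter> W = {}"
  shows "sgn_determined V {x. \<exists>y. (\<lambda>i. if i \<in> W then y i else x i) \<in> A}"
  using assms
proof (induction W arbitrary: V)
  case empty
  then show ?case by simp
next
  case (insert a W)
  have "sgn_determined (insert a V) {x. \<exists>y. (\<lambda>i. if i \<in> W then y i else x i) \<in> A}"
    using insert.prems insert.hyps by (intro insert.IH) auto
  then have "sgn_determined V {x. \<exists>z. x(a := z) \<in> {x. \<exists>y. (\<lambda>i. if i \<in> W then y i else x i) \<in> A}}"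
    using insert.prems by (intro sgn_determined_project) auto
  moreover have "(\<exists>z. x(a := z) \<in> {x. \<exists>y. (\<lambda>i. if i \<in> W then y i else x i) \<in> A}) \<longleftrightarrow>
      (\<exists>y. (\<lambda>i. if i \<in> insert a W then y i else x i) \<in> A)" for x
  proof
    assume "\<exists>z. x(a := z) \<in> {x. \<exists>y. (\<lambda>i. if i \<in> W then y i else x i) \<in> A}"
    then obtain z y where zy: "(\<lambda>i. if i \<in> W then y i else (x(a := z)) i) \<in> A" by blast
    have "(\<lambda>i. if i \<in> W then y i else (x(a := z)) i) = (\<lambda>i. if i \<in> insert a W then (y(a := z)) i else x i)"
      using insert.hyps by auto
    then show "\<exists>y. (\<lambda>i. if i \<in> insert a W then y i else x i) \<in> A" using zy by metis
  next
    assume "\<exists>y. (\<lambda>i. if i \<in> insert a W then y i else x i) \<in> A"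
    then obtain y where y: "(\<lambda>i. if i \<in> insert a W then y i else x i) \<in> A" by blast
    have "(\<lambda>i. if i \<in> insert a W then y i else x i) = (\<lambda>i. if i \<in> W then y i else (x(a := y a)) i)"
      by auto
    then show "\<exists>z. x(a := z) \<in> {x. \<exists>y. (\<lambda>i. if i \<in> W then y i else x i) \<in> A}"
      using y by auto
  qed
  ultimately show ?case by simp
qed

section \<open>The Lojasiewicz inequality\<close>

text \<open>Near 0 a nonzero polynomial is comparable to \<open>t ^ order 0 A\<close>; one further
  factor \<open>t\<close> absorbs the constant.\<close>

lemma poly_power_lower_bound:
  fixes A :: "real poly"
  assumes "A \<noteq> 0"
  shows "\<exists>K. eventually (\<lambda>t. t ^ K \<le> \<bar>poly A t\<bar>) (at_right 0)"
proof -
  obtain B where B: "A = [:-0, 1:] ^ order 0 A * B" "\<not> [:-0, 1:] dvd B"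
    using order_decomp[OF assms, of 0] by blast
  have B0: "poly B 0 \<noteq> 0" using B(2) poly_eq_0_iff_dvd[of B 0] by simp
  have "((\<lambda>t. \<bar>poly B t\<bar>) \<longlongrightarrow> \<bar>poly B 0\<bar>) (at_right 0)"
    by (intro tendsto_intros)
  then have "eventually (\<lambda>t. \<bar>poly B 0\<bar> / 2 < \<bar>poly B t\<bar>) (at_right 0)"
    by (rule order_tendstoD) (use B0 in simp)
  moreover have "eventually (\<lambda>t. t \<in> {0<..<\<bar>poly B 0\<bar> / 2}) (at_right (0::real))"
    by (rule eventually_at_right_real) (use B0 in simp)
  ultimately have "eventually (\<lambda>t. t ^ Suc (order 0 A) \<le> \<bar>poly A t\<bar>) (at_right 0)"
  proof eventually_elim
    case (elim t)
    then have "t ^ Suc (order 0 A) \<le> t ^ order 0 A * \<bar>poly B t\<bar>"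
      by (subst power_Suc2) (intro mult_left_mono, auto)
    also have "\<dots> = \<bar>poly A t\<bar>" using elim by (subst B(1)) (simp add: abs_mult power_abs)
    finally show ?case .
  qed
  then show ?thesis by blast
qed

text \<open>Divide the equation by \<open>s ^ m\<close>, where \<open>A m\<close> is the first
  coefficient that is not the zero polynomial. For \<open>s \<le> 1\<close> the other terms add up
  to at most \<open>M * s\<close>, while the value of \<open>A m\<close> at \<open>t\<close> is in
  modulus at least a power of \<open>t\<close>; one further factor \<open>t < 1 / M\<close> absorbs
  \<open>M\<close>.\<close>

lemma positive_root_lower_bound:
  fixes A :: "nat \<Rightarrow> real poly"
  assumes "j \<le> d" "A j \<noteq> 0"
  shows "\<exists>K. eventually (\<lambda>t. \<forall>s>0. (\<Sum>j\<le>d. poly (A j) t * s ^ j) = 0 \<longrightarrow> t ^ K \<le> s) (at_right 0)"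
proof -
  define m where "m = (LEAST j. A j \<noteq> 0)"
  have m: "A m \<noteq> 0" "m \<le> d"
    using LeastI[of "\<lambda>j. A j \<noteq> 0", OF assms(2)] Least_le[of "\<lambda>j. A j \<noteq> 0", OF assms(2)] assms(1)
    unfolding m_def by linarith+
  have below: "A j = 0" if "j < m" for j
    using not_less_Least[OF that[unfolded m_def]] by simp
  \<comment> \<open>Bounds the sum of the moduli of all coefficients for \<open>t\<close> near 0;
    the leading 1 gives \<open>1 / M \<le> 1\<close>.\<close>
  define M where "M = 1 + (\<Sum>j\<le>d. \<bar>poly (A j) 0\<bar> + 1)"
  have M: "M \<ge> 1" unfolding M_def by (simp add: sum_nonneg)
  obtain K where "eventually (\<lambda>t. t ^ K \<le> \<bar>poly (A m) t\<bar>) (at_right 0)"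
    using poly_power_lower_bound[OF m(1)] by blast
  moreover have "eventually (\<lambda>t. \<forall>j\<in>{..d}. \<bar>poly (A j) t\<bar> < \<bar>poly (A j) 0\<bar> + 1) (at_right 0)"
  proof (rule eventually_ball_finite)
    show "\<forall>j\<in>{..d}. \<forall>\<^sub>F t in at_right 0. \<bar>poly (A j) t\<bar> < \<bar>poly (A j) 0\<bar> + 1"
    proof
      fix j
      have "((\<lambda>t. \<bar>poly (A j) t\<bar>) \<longlongrightarrow> \<bar>poly (A j) 0\<bar>) (at_right 0)" by (intro tendsto_intros)
      then show "\<forall>\<^sub>F t in at_right 0. \<bar>poly (A j) t\<bar> < \<bar>poly (A j) 0\<bar> + 1"
        by (rule order_tendstoD) simp
    qed
  qed simp
  moreover have "eventually (\<lambda>t. t \<in> {0<..<1 / M}) (at_right (0::real))"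
    by (rule eventually_at_right_real) (use M in simp)
  ultimately have "eventually (\<lambda>t. \<forall>s>0. (\<Sum>j\<le>d. poly (A j) t * s ^ j) = 0 \<longrightarrow> t ^ Suc K \<le> s) (at_right 0)"
  proof eventually_elim
    case (elim t)
    moreover have "1 / M \<le> 1" using M by simp
    ultimately have t: "0 < t" "t < 1 / M" "t \<le> 1" by auto
    show ?case
    proof (intro allI impI)
      fix s :: real
      assume s: "s > 0" "(\<Sum>j\<le>d. poly (A j) t * s ^ j) = 0"
      show "t ^ Suc K \<le> s"
      proof (cases "s \<le> 1")
        case False
        have "t ^ Suc K \<le> 1" using t by (intro power_le_one) auto
        then show ?thesis using False by simp
      next
        case True
        have "(\<Sum>j\<le>d. poly (A j) t * s ^ j) = poly (A m) t * s ^ m + (\<Sum>j\<in>{..d} - {m}. poly (A j) t * s ^ j)"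
          using m by (intro sum.remove) auto
        then have "\<bar>poly (A m) t * s ^ m\<bar> = \<bar>\<Sum>j\<in>{..d} - {m}. poly (A j) t * s ^ j\<bar>"
          using s by linarith
        also have "\<dots> \<le> (\<Sum>j\<in>{..d} - {m}. \<bar>poly (A j) t * s ^ j\<bar>)" by (rule sum_abs)
        also have "\<dots> \<le> (\<Sum>j\<in>{..d} - {m}. (\<bar>poly (A j) 0\<bar> + 1) * s ^ Suc m)"
        proof (rule sum_mono)
          fix j assume j: "j \<in> {..d} - {m}"
          show "\<bar>poly (A j) t * s ^ j\<bar> \<le> (\<bar>poly (A j) 0\<bar> + 1) * s ^ Suc m"
          proof (cases "j < m")
            case True
            then show ?thesis using below s by simp
          next
            case False
            then have "s ^ j \<le> s ^ Suc m" using j s True by (intro power_decreasing) auto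
            moreover have "\<bar>poly (A j) t\<bar> \<le> \<bar>poly (A j) 0\<bar> + 1" using elim(2) j by force
            ultimately show ?thesis unfolding abs_mult using s by (intro mult_mono) auto
          qed
        qed
        also have "\<dots> = (\<Sum>j\<in>{..d} - {m}. \<bar>poly (A j) 0\<bar> + 1) * s ^ Suc m"
          by (rule sum_distrib_right[symmetric])
        also have "\<dots> \<le> M * s ^ Suc m"
        proof (rule mult_right_mono)
          have "(\<Sum>j\<in>{..d} - {m}. \<bar>poly (A j) 0\<bar> + 1) \<le> (\<Sum>j\<le>d. \<bar>poly (A j) 0\<bar> + 1)"
            by (rule sum_mono2) auto
          then show "(\<Sum>j\<in>{..d} - {m}. \<bar>poly (A j) 0\<bar> + 1) \<le> M" unfolding M_def by simp
        qed (use s in simp)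
        finally have "\<bar>poly (A m) t\<bar> * s ^ m \<le> (M * s) * s ^ m"
          using s by (simp add: abs_mult mult.assoc)
        then have "\<bar>poly (A m) t\<bar> \<le> M * s" using s by simp
        then have "t ^ K \<le> M * s" using elim(1) by linarith
        then have "t ^ K / M \<le> s" using M by (simp add: field_simps)
        moreover have "t ^ Suc K \<le> t ^ K / M"
          using mult_left_mono[of t "1 / M" "t ^ K"] t by (simp add: mult.commute)
        ultimately show ?thesis by linarith
      qed
    qed
  qed
  then show ?thesis by blast
qed

lemma pfun_two_variables:
  assumes "pfun {a, b} q"
  obtains A :: "nat \<Rightarrow> real poly" and d where "\<And>z. q z = (\<Sum>j\<le>d. poly (A j) (z b) * z a ^ j)"
proof -
  obtain d P where P: "pfun_poly {b} d P" "\<And>z. q z = poly (P z) (z a)"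
    using pfun_insert_poly[of a "{b}" q] assms by metis
  have "\<exists>A. \<forall>z. coeff (P z) j = poly A (z b)" for j
  proof -
    have "pfun (insert b {}) (\<lambda>z. coeff (P z) j)" using P(1) by (simp add: pfun_poly_def)
    then obtain e C where C: "pfun_poly {} e C" "\<And>z. coeff (P z) j = poly (C z) (z b)"
      using pfun_insert_poly[of b "{}"] by metis
    have "C z = C (\<lambda>_. 0)" for z
    proof -
      have "coeff (C z) k = coeff (C (\<lambda>_. 0)) k" for k
        using C(1) by (intro pfun_cong[of "{}" "\<lambda>z. coeff (C z) k"]) (auto simp: pfun_poly_def)
      then show ?thesis by (simp add: poly_eq_iff)
    qed
    then show ?thesis using C(2) by metis
  qed
  then obtain A where A: "\<And>j z. coeff (P z) j = poly (A j) (z b)" by metis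
  have "q z = (\<Sum>j\<le>d. poly (A j) (z b) * z a ^ j)" for z
  proof -
    have "poly (P z) (z a) = (\<Sum>j\<le>d. coeff (P z) j * z a ^ j)"
      unfolding poly_altdef using P(1)
      by (intro sum.mono_neutral_left) (auto simp: pfun_poly_def intro: coeff_eq_0)
    then show ?thesis using P(2) A by simp
  qed
  then show thesis using that by blast
qed

text \<open>Over each value \<open>t\<close> of coordinate \<open>b\<close> the least point of the fibre is a zero of one of the polynomials whose signs
  determine the set, since otherwise nearby smaller points would have the same signs.\<close>

lemma sgn_determined_fibre_minimum:
  assumes S: "sgn_determined {a, b} S" and "a \<noteq> b"
  shows "\<exists>K. eventually (\<lambda>t. \<forall>z\<in>S. z b = t \<and> z a > 0 \<and> (\<forall>s. 0 < s \<and> s < z a \<longrightarrow> z(a := s) \<notin> S)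
           \<longrightarrow> t ^ K \<le> z a) (at_right 0)"
proof -
  obtain Q where Q: "finite Q" "\<And>q. q \<in> Q \<Longrightarrow> pfun {a, b} q" "\<And>z z'. sgn_eq Q z z' \<Longrightarrow> z \<in> S \<longleftrightarrow> z' \<in> S"
    using sgn_determinedE[OF S] by metis
  have "\<exists>A d. \<forall>z. q z = (\<Sum>j\<le>d. poly (A j) (z b) * z a ^ j)" if "q \<in> Q" for q
    using pfun_two_variables[OF Q(2)[OF that]] by metis
  then obtain A d where A: "\<And>q z. q \<in> Q \<Longrightarrow> q z = (\<Sum>j\<le>d q. poly (A q j) (z b) * z a ^ j)"
    by metis
  \<comment> \<open>The omitted members of \<open>Q\<close> vanish identically, so their signs never
    change.\<close>
  define Q0 where "Q0 = {q\<in>Q. \<exists>j\<le>d q. A q j \<noteq> 0}"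
  have "\<exists>K. eventually (\<lambda>t. \<forall>s>0. (\<Sum>j\<le>d q. poly (A q j) t * s ^ j) = 0 \<longrightarrow> t ^ K \<le> s) (at_right 0)"
    if "q \<in> Q0" for q
    using that positive_root_lower_bound by (auto simp: Q0_def)
  then have "\<forall>q\<in>Q0. \<exists>K. eventually (\<lambda>t. \<forall>s>0. (\<Sum>j\<le>d q. poly (A q j) t * s ^ j) = 0 \<longrightarrow> t ^ K \<le> s) (at_right 0)"
    ..
  from bchoice[OF this] obtain K where K: "\<forall>q\<in>Q0.
      eventually (\<lambda>t. \<forall>s>0. (\<Sum>j\<le>d q. poly (A q j) t * s ^ j) = 0 \<longrightarrow> t ^ K q \<le> s) (at_right 0)"
    ..
  have finQ0: "finite Q0" using Q(1) by (simp add: Q0_def)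
  have "eventually (\<lambda>t. \<forall>q\<in>Q0. \<forall>s>0. (\<Sum>j\<le>d q. poly (A q j) t * s ^ j) = 0 \<longrightarrow> t ^ K q \<le> s) (at_right 0)"
    using eventually_ball_finite[OF finQ0 K] .
  moreover have "eventually (\<lambda>t. t \<in> {0<..<1}) (at_right (0::real))"
    by (rule eventually_at_right_real) simp
  ultimately have "eventually (\<lambda>t. \<forall>z\<in>S. z b = t \<and> z a > 0 \<and> (\<forall>s. 0 < s \<and> s < z a \<longrightarrow> z(a := s) \<notin> S)
           \<longrightarrow> t ^ sum K Q0 \<le> z a) (at_right 0)"
  proof eventually_elim
    case (elim t)
    show ?case
    proof (intro ballI impI, elim conjE)
      fix z assume z: "z \<in> S" "z b = t" "z a > 0" and min: "\<forall>s. 0 < s \<and> s < z a \<longrightarrow> z(a := s) \<notin> S"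
      have "\<exists>q\<in>Q0. q z = 0"
      proof (rule ccontr)
        assume neg: "\<not> ?thesis"
        have "eventually (\<lambda>s. sgn (q (z(a := s))) = sgn (q z)) (at_left (z a))" if q: "q \<in> Q" for q
        proof (cases "q \<in> Q0")
          case False
          then have "q w = 0" for w using A[OF q, of w] q by (auto simp: Q0_def)
          then show ?thesis by simp
        next
          case True
          have "q (z(a := s)) = (\<Sum>j\<le>d q. poly (A q j) t * s ^ j)" for s
            using A[OF q] z(2) \<open>a \<noteq> b\<close> by simp
          then have "((\<lambda>s. q (z(a := s))) \<longlongrightarrow> (\<Sum>j\<le>d q. poly (A q j) t * z a ^ j)) (at_left (z a))"
            by (simp only:) (intro tendsto_intros)
          then have lim: "((\<lambda>s. q (z(a := s))) \<longlongrightarrow> q z) (at_left (z a))"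
            using A[OF q, of z] z(2) by simp
          consider "q z > 0" | "q z < 0" using neg True by fastforce
          then show ?thesis
          proof cases
            case 1
            show ?thesis using order_tendstoD(1)[OF lim 1] by eventually_elim (use 1 in simp)
          next
            case 2
            show ?thesis using order_tendstoD(2)[OF lim 2] by eventually_elim (use 2 in simp)
          qed
        qed
        then have "eventually (\<lambda>s. \<forall>q\<in>Q. sgn (q (z(a := s))) = sgn (q z)) (at_left (z a))"
          using Q(1) by (intro eventually_ball_finite) auto
        moreover have "eventually (\<lambda>s. s \<in> {0<..<z a}) (at_left (z a))"
          using z(3) by (rule eventually_at_left_real)
        ultimately have "eventually (\<lambda>s. sgn_eq Q (z(a := s)) z \<and> 0 < s \<and> s < z a) (at_left (z a))"
          by eventually_elim (auto simp: sgn_eq_def)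
        then obtain s where "sgn_eq Q (z(a := s)) z" "0 < s" "s < z a"
          using eventually_happens'[OF trivial_limit_at_left_real] by blast
        then show False using min z(1) Q(3) by blast
      qed
      then obtain q where q: "q \<in> Q0" "q z = 0" by blast
      then have "(\<Sum>j\<le>d q. poly (A q j) t * z a ^ j) = 0"
        using A[of q z] z(2) by (auto simp: Q0_def)
      then have "t ^ K q \<le> z a" using elim(1) q z(3) by blast
      \<comment> \<open>Since \<open>t < 1\<close>, the sum of the exponents serves for every
        \<open>q\<close> at once.\<close>
      moreover have "t ^ sum K Q0 \<le> t ^ K q"
        using elim(2) q finQ0 by (intro power_decreasing member_le_sum) auto
      ultimately show "t ^ sum K Q0 \<le> z a" by linarith
    qed
  qed
  then show ?thesis by blast
qed

lemma proj_first_pfun: "pfun {..<n} f \<Longrightarrow> f (proj_first n x) = f x"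
  by (erule pfun_cong) (simp add: proj_first_def)

text \<open>The pairs of values of \<open>f\<close> and \<open>g\<close> on \<open>A\<close> form a
  plane set determined by signs. On a level set of \<open>g\<close> compactness yields a least value
  of \<open>f\<close>, positive by \<open>zero\<close> if the level is positive, and for small
  levels \<open>sgn_determined_fibre_minimum\<close> bounds it below by a power of the level. On the
  remaining levels \<open>f\<close> is bounded below and \<open>g\<close> above by compactness. The
  exponent \<open>Suc N\<close> makes the left side vanish where \<open>g\<close> does.\<close>

theorem Lojasiewicz_inequality:
  assumes A: "compact A" "sgn_determined {..<n} {x. proj_first n x \<in> A}"
      "\<And>x. x \<in> A \<Longrightarrow> proj_first n x = x"
    and fg: "pfun {..<n} f" "pfun {..<n} g"
    and nn: "\<And>x. x \<in> A \<Longrightarrow> f x \<ge> 0" "\<And>x. x \<in> A \<Longrightarrow> g x \<ge> 0"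
    and zero: "\<And>x. x \<in> A \<Longrightarrow> f x = 0 \<Longrightarrow> g x = 0"
  shows "\<exists>N C. \<forall>x\<in>A. g x ^ Suc N \<le> C * f x"
proof -
  \<comment> \<open>Coordinates \<open>n\<close> and \<open>Suc n\<close> are free of the variables
    of \<open>f\<close> and \<open>g\<close> and carry their values; projecting away the first
    \<open>n\<close> coordinates leaves the plane set \<open>S\<close>.\<close>
  define T where "T = {x. proj_first n x \<in> A} \<inter> ({z. f z - z n = 0} \<inter> {z. g z - z (Suc n) = 0})"
  define S where "S = {z. \<exists>y. (\<lambda>i. if i \<in> {..<n} then y i else z i) \<in> T}"
  have fg': "pfun ({n, Suc n} \<union> {..<n}) f" "pfun ({n, Suc n} \<union> {..<n}) g"
    using fg pfun_mono by blast+
  have "sgn_determined ({n, Suc n} \<union> {..<n}) T"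
    unfolding T_def using fg' A(2)
    by (intro sgn_determined_Int sgn_determined_zero pfun_diff pfun.var)
      (auto intro: sgn_determined_mono)
  then have "sgn_determined {n, Suc n} S"
    unfolding S_def by (intro sgn_determined_project_finite) auto
  then obtain K where "eventually (\<lambda>t. \<forall>z\<in>S. z (Suc n) = t \<and> z n > 0 \<and>
      (\<forall>s. 0 < s \<and> s < z n \<longrightarrow> z(n := s) \<notin> S) \<longrightarrow> t ^ K \<le> z n) (at_right 0)"
    using sgn_determined_fibre_minimum[of n "Suc n" S] by auto
  then have "\<exists>b>0. \<forall>t>0. t < b \<longrightarrow> (\<forall>z\<in>S. z (Suc n) = t \<and> z n > 0 \<and>
      (\<forall>s. 0 < s \<and> s < z n \<longrightarrow> z(n := s) \<notin> S) \<longrightarrow> t ^ K \<le> z n)"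
    by (simp only: eventually_at_right_field)
  then obtain \<delta>' where \<delta>'0: "\<delta>' > 0" and "\<forall>t>0. t < \<delta>' \<longrightarrow> (\<forall>z\<in>S. z (Suc n) = t \<and> z n > 0 \<and>
      (\<forall>s. 0 < s \<and> s < z n \<longrightarrow> z(n := s) \<notin> S) \<longrightarrow> t ^ K \<le> z n)"
    by (elim exE conjE)
  then have \<delta>': "t ^ K \<le> z n" if "0 < t" "t < \<delta>'" "z \<in> S" "z (Suc n) = t" "z n > 0"
      "\<And>s. 0 < s \<Longrightarrow> s < z n \<Longrightarrow> z(n := s) \<notin> S" for t z
    using that by simp
  \<comment> \<open>The bound by 1 later allows passing from \<open>g x ^ Suc K\<close> to
    \<open>g x ^ K\<close>.\<close>
  define \<delta> where "\<delta> = min \<delta>' 1"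
  have S_iff: "z \<in> S \<longleftrightarrow> (\<exists>x\<in>A. f x = z n \<and> g x = z (Suc n))" for z
  proof
    assume "z \<in> S"
    then obtain y where y: "(\<lambda>i. if i \<in> {..<n} then y i else z i) \<in> T" unfolding S_def by blast
    define w where "w = (\<lambda>i. if i \<in> {..<n} then y i else z i)"
    have "proj_first n w \<in> A" "f w = z n" "g w = z (Suc n)"
      using y unfolding w_def[symmetric] T_def by (auto simp: w_def)
    then show "\<exists>x\<in>A. f x = z n \<and> g x = z (Suc n)"
      using proj_first_pfun[OF fg(1), of w] proj_first_pfun[OF fg(2), of w] by metis
  next
    assume "\<exists>x\<in>A. f x = z n \<and> g x = z (Suc n)"
    then obtain x where x: "x \<in> A" "f x = z n" "g x = z (Suc n)" by blast
    define w where "w = (\<lambda>i. if i \<in> {..<n} then x i else z i)"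
    have "proj_first n w = proj_first n x" unfolding w_def proj_first_def by (auto simp: fun_eq_iff)
    then have pw: "proj_first n w = x" using A(3)[OF x(1)] by simp
    have "f w = f x" "g w = g x"
      using proj_first_pfun[OF fg(1), of w] proj_first_pfun[OF fg(2), of w] unfolding pw by simp_all
    moreover have "w n = z n" "w (Suc n) = z (Suc n)" by (simp_all add: w_def)
    ultimately have "w \<in> T" using pw x by (simp add: T_def)
    then show "z \<in> S" unfolding S_def w_def by blast
  qed
  have cont: "continuous_on X f" "continuous_on X g" for X using fg pfun_continuous by auto
  have small: "g x ^ K \<le> f x" if x: "x \<in> A" "0 < g x" "g x < \<delta>" for x
  proof -
    define A' where "A' = A \<inter> g -` {g x}"
    have "compact A'" unfolding A'_def
      using A(1) cont(2)[of UNIV] by (intro compact_Int_closed closed_vimage) auto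
    moreover have "A' \<noteq> {}" using x by (auto simp: A'_def)
    ultimately obtain x0 where x0: "x0 \<in> A'" "\<And>y. y \<in> A' \<Longrightarrow> f x0 \<le> f y"
      using continuous_attains_inf[OF _ _ cont(1)] by metis
    then have x0A: "x0 \<in> A" "g x0 = g x" by (auto simp: A'_def)
    then have "f x0 > 0" using nn(1) zero x by (metis less_irrefl order_le_less)
    define z :: "nat \<Rightarrow> real" where "z = (\<lambda>_. 0)(n := f x0, Suc n := g x)"
    have "z \<in> S" using x0A by (auto simp: S_iff z_def)
    moreover have "z(n := s) \<notin> S" if "0 < s" "s < z n" for s
    proof
      assume "z(n := s) \<in> S"
      then obtain y where "y \<in> A" "f y = s" "g y = g x" by (auto simp: S_iff z_def)
      then show False using x0(2)[of y] that by (auto simp: A'_def z_def)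
    qed
    moreover have "z n = f x0" "z (Suc n) = g x" by (simp_all add: z_def)
    ultimately have "g x ^ K \<le> z n"
      using \<delta>'[of "g x" z] \<open>f x0 > 0\<close> x by (simp add: \<delta>_def)
    also have "z n \<le> f x" using x0(2)[of x] x by (simp add: z_def A'_def)
    finally show ?thesis .
  qed
  obtain G where G: "\<And>x. x \<in> A \<Longrightarrow> g x \<le> G" "G \<ge> 0"
  proof -
    have "bounded (g ` A)" using A(1) cont(2) by (intro compact_imp_bounded compact_continuous_image)
    then obtain G where "\<And>y. y \<in> g ` A \<Longrightarrow> norm y \<le> G" by (auto simp: bounded_iff)
    then have "g x \<le> max G 0" if "x \<in> A" for x using that by force
    then show thesis using that[of "max G 0"] by simp
  qed
  obtain m where m: "m > 0" "\<And>x. x \<in> A \<Longrightarrow> \<delta> \<le> g x \<Longrightarrow> m \<le> f x"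
  proof (cases "A \<inter> g -` {\<delta>..} = {}")
    case True
    then show thesis using that[of 1] by auto
  next
    case False
    have "compact (A \<inter> g -` {\<delta>..})"
      using A(1) cont(2)[of UNIV] by (intro compact_Int_closed closed_vimage) auto
    then obtain x0 where x0: "x0 \<in> A \<inter> g -` {\<delta>..}" "\<And>y. y \<in> A \<inter> g -` {\<delta>..} \<Longrightarrow> f x0 \<le> f y"
      using continuous_attains_inf[OF _ False cont(1)] by metis
    have "\<delta> > 0" using \<delta>'0 by (simp add: \<delta>_def)
    then have "f x0 > 0" using x0(1) nn(1)[of x0] zero[of x0] by force
    then show thesis using that[of "f x0"] x0 by auto
  qed
  \<comment> \<open>The quotient is for levels of \<open>g\<close> from \<open>\<delta>\<close> on,
    the summand 1 for those below.\<close>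
  define C where "C = 1 + G ^ Suc K / m"
  have C: "C \<ge> 1" "G ^ Suc K \<le> C * m" using G(2) m(1) by (auto simp: C_def field_simps)
  have "g x ^ Suc K \<le> C * f x" if x: "x \<in> A" for x
  proof -
    consider "g x = 0" | "0 < g x" "g x < \<delta>" | "\<delta> \<le> g x" using nn(2)[OF x] by linarith
    then show ?thesis
    proof cases
      case 1
      then show ?thesis using C nn(1)[OF x] by simp
    next
      case 2
      then have "g x ^ Suc K \<le> g x ^ K" by (intro power_decreasing) (auto simp: \<delta>_def)
      also have "\<dots> \<le> f x" using small 2 x by simp
      also have "\<dots> \<le> C * f x" using C nn(1)[OF x] by (simp add: mult_le_cancel_right1)
      finally show ?thesis .
    next
      case 3
      have "g x ^ Suc K \<le> G ^ Suc K" using G x nn(2) by (intro power_mono) auto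
      also have "\<dots> \<le> C * m" by (rule C)
      also have "\<dots> \<le> C * f x" using C m(2)[OF x 3] by (intro mult_left_mono) auto
      finally show ?thesis .
    qed
  qed
  then show ?thesis by blast
qed

section \<open>Binary games as circuits\<close>

text \<open>Independent mixing can be averaged one coordinate at a time, and affinity in that
  coordinate turns the average into evaluation at the mixed strategy. The values \<open>z\<close>
  outside \<open>V\<close> are arbitrary so that a coordinate set to 0 or 1 can be moved into
  them.\<close>

lemma expectation_multi_affine:
  fixes f :: "(nat \<Rightarrow> real) \<Rightarrow> real"
  assumes "finite V" and aff: "\<And>j x t. f (x(j := t)) = t * f (x(j := 1)) + (1 - t) * f (x(j := 0))"
  shows "(\<Sum>s\<in>V \<rightarrow>\<^sub>E UNIV. (\<Prod>j\<in>V. if s j then x j else 1 - x j) *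
     f (\<lambda>j. if j \<in> V then of_bool (s j) else z j)) = f (\<lambda>j. if j \<in> V then x j else z j)"
  using assms(1)
proof (induction V arbitrary: z)
  case empty
  then show ?case by simp
next
  case (insert a V)
  define w where "w s = (\<Prod>j\<in>V. if s j then x j else 1 - x j)" for s
  define F where "F s = f (\<lambda>j. if j \<in> insert a V then of_bool (s j) else z j)" for s
  have inj: "inj_on (\<lambda>(y, g). g(a := y)) ((UNIV :: bool set) \<times> (V \<rightarrow>\<^sub>E UNIV))"
  proof (rule inj_onI, clarify)
    fix y y' :: bool and g g' assume g: "g \<in> V \<rightarrow>\<^sub>E (UNIV :: bool set)" "g' \<in> V \<rightarrow>\<^sub>E UNIV"
      and eq: "g(a := y) = g'(a := y')"
    have "y = y'" using fun_cong[OF eq, of a] by simp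
    moreover have "g i = g' i" for i
      using fun_cong[OF eq, of i] PiE_arb[OF g(1) insert.hyps(2)] PiE_arb[OF g(2) insert.hyps(2)]
      by (cases "i = a") auto
    ultimately show "y = y' \<and> g = g'" by auto
  qed
  have upd: "w (g(a := y)) = w g" for g y
    unfolding w_def using insert.hyps by (intro prod.cong) auto
  have "(\<Sum>s\<in>insert a V \<rightarrow>\<^sub>E UNIV. (\<Prod>j\<in>insert a V. if s j then x j else 1 - x j) * F s) =
      (\<Sum>(y, g)\<in>UNIV \<times> (V \<rightarrow>\<^sub>E UNIV). (if y then x a else 1 - x a) * w g * F (g(a := y)))"
    unfolding PiE_insert_eq sum.reindex[OF inj] using insert.hyps upd
    by (intro sum.cong) (auto simp: w_def[symmetric])
  also have "\<dots> = (\<Sum>y\<in>UNIV. \<Sum>g\<in>V \<rightarrow>\<^sub>E UNIV. (if y then x a else 1 - x a) * w g * F (g(a := y)))"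
    by (rule sum.cartesian_product[symmetric])
  also have "\<dots> = (\<Sum>y\<in>UNIV. (if y then x a else 1 - x a) *
      (\<Sum>g\<in>V \<rightarrow>\<^sub>E UNIV. w g * f (\<lambda>j. if j \<in> V then of_bool (g j) else (z(a := of_bool y)) j)))"
  proof -
    have "F (g(a := y)) = f (\<lambda>j. if j \<in> V then of_bool (g j) else (z(a := of_bool y)) j)" for g y
      unfolding F_def using insert.hyps by (intro arg_cong[of _ _ f]) auto
    then show ?thesis by (simp add: sum_distrib_left mult.assoc)
  qed
  also have "\<dots> = (\<Sum>y\<in>UNIV. (if y then x a else 1 - x a) * f (\<lambda>j. if j \<in> V then x j else (z(a := of_bool y)) j))"
    unfolding w_def insert.IH ..
  also have "\<dots> = x a * f (\<lambda>j. if j \<in> V then x j else (z(a := 1)) j) +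
      (1 - x a) * f (\<lambda>j. if j \<in> V then x j else (z(a := 0)) j)"
    by (simp add: UNIV_bool)
  also have "\<dots> = f (\<lambda>j. if j \<in> insert a V then x j else z j)"
  proof -
    define X where "X = (\<lambda>j. if j \<in> V then x j else z j)"
    have "(\<lambda>j. if j \<in> V then x j else (z(a := t)) j) = X(a := t)" for t
      using insert.hyps by (auto simp: X_def)
    moreover have "(\<lambda>j. if j \<in> insert a V then x j else z j) = X(a := x a)" by (auto simp: X_def)
    ultimately show ?thesis using aff[of X a "x a"] by simp
  qed
  finally show ?case unfolding F_def .
qed

text \<open>Expected payoffs have this form in the mixed strategies, so incentives and gates are
  restricted to it.\<close>

definition multi_affine :: "((nat \<Rightarrow> real) \<Rightarrow> real) \<Rightarrow> bool" where
  "multi_affine f \<longleftrightarrow> (\<forall>x j t. f (x(j := t)) = t * f (x(j := 1)) + (1 - t) * f (x(j := 0)))"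

definition depends_on :: "nat set \<Rightarrow> ((nat \<Rightarrow> real) \<Rightarrow> real) \<Rightarrow> bool" where
  "depends_on V f \<longleftrightarrow> (\<forall>x y. (\<forall>i\<in>V. x i = y i) \<longrightarrow> f x = f y)"

lemma depends_on_mono: "depends_on V f \<Longrightarrow> V \<subseteq> W \<Longrightarrow> depends_on W f"
  unfolding depends_on_def by blast

lemma depends_on_const: "depends_on V (\<lambda>x. c)"
  by (simp add: depends_on_def)

lemma depends_on_var: "i \<in> V \<Longrightarrow> depends_on V (\<lambda>x. x i)"
  by (simp add: depends_on_def)

lemma depends_on_diff: "depends_on V f \<Longrightarrow> depends_on V g \<Longrightarrow> depends_on V (\<lambda>x. f x - g x)"
  unfolding depends_on_def by metis

lemma depends_on_mult: "depends_on V f \<Longrightarrow> depends_on V g \<Longrightarrow> depends_on V (\<lambda>x. f x * g x)"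
  unfolding depends_on_def by metis

lemma depends_on_upd: "depends_on V f \<Longrightarrow> i \<notin> V \<Longrightarrow> f (x(i := t)) = f x"
  unfolding depends_on_def by (metis fun_upd_other)

lemma multi_affine_const: "multi_affine (\<lambda>x. c)"
  by (simp add: multi_affine_def algebra_simps)

lemma multi_affine_var: "multi_affine (\<lambda>x. x i)"
  by (simp add: multi_affine_def algebra_simps)

lemma multi_affine_add: "multi_affine f \<Longrightarrow> multi_affine g \<Longrightarrow> multi_affine (\<lambda>x. f x + g x)"
  unfolding multi_affine_def
proof (intro allI)
  fix x j t
  assume f: "\<forall>x j t. f (x(j := t)) = t * f (x(j := 1)) + (1 - t) * f (x(j := 0))"
    and g: "\<forall>x j t. g (x(j := t)) = t * g (x(j := 1)) + (1 - t) * g (x(j := 0))"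
  show "f (x(j := t)) + g (x(j := t)) = t * (f (x(j := 1)) + g (x(j := 1))) + (1 - t) * (f (x(j := 0)) + g (x(j := 0)))"
    unfolding f[rule_format, of x j t] g[rule_format, of x j t] by (simp add: algebra_simps)
qed

text \<open>With disjoint variables, each coordinate moves at most one factor.\<close>

lemma multi_affine_mult:
  assumes f: "multi_affine f" "depends_on V f" and g: "multi_affine g" "depends_on W g"
    and disj: "V \<inter> W = {}"
  shows "multi_affine (\<lambda>x. f x * g x)"
  unfolding multi_affine_def
proof (intro allI)
  fix x j t
  have fj: "f (x(j := t)) = t * f (x(j := 1)) + (1 - t) * f (x(j := 0))"
    using f(1) unfolding multi_affine_def by blast
  have gj: "g (x(j := t)) = t * g (x(j := 1)) + (1 - t) * g (x(j := 0))"
    using g(1) unfolding multi_affine_def by blast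
  show "f (x(j := t)) * g (x(j := t)) = t * (f (x(j := 1)) * g (x(j := 1))) + (1 - t) * (f (x(j := 0)) * g (x(j := 0)))"
  proof (cases "j \<in> V")
    case True
    then have "g (x(j := s)) = g x" for s using depends_on_upd[OF g(2)] disj by blast
    then show ?thesis unfolding fj by (simp add: algebra_simps)
  next
    case False
    then have "f (x(j := s)) = f x" for s using depends_on_upd[OF f(2)] by blast
    then show ?thesis unfolding gj by (simp add: algebra_simps)
  qed
qed

lemma multi_affine_diff: "multi_affine f \<Longrightarrow> multi_affine g \<Longrightarrow> multi_affine (\<lambda>x. f x - g x)"
proof -
  assume f: "multi_affine f" and g: "multi_affine g"
  have "multi_affine (\<lambda>x. - 1 * g x)"
  proof (rule multi_affine_mult[OF multi_affine_const depends_on_const[of "{}"] g])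
    have "x = y" if "\<forall>i\<in>UNIV. x i = y i" for x y :: "nat \<Rightarrow> real" using that by auto
    then show "depends_on UNIV g" unfolding depends_on_def by metis
  qed simp
  from multi_affine_add[OF f this] show ?thesis by simp
qed

text \<open>The second strategy is normalised to payoff 0, so \<open>D i\<close> is the advantage of
  the first one, read at the pure profile as a 0-1 vector.\<close>

definition incentive_payoffs :: "nat \<Rightarrow> (nat \<Rightarrow> (nat \<Rightarrow> real) \<Rightarrow> real) \<Rightarrow> payoffs" where
  "incentive_payoffs N D i s = (if s i then D i (\<lambda>j. if j < N then of_bool (s j) else 0) else 0)"

lemma expected_incentive_payoffs:
  assumes x: "x \<in> unit_cube N" and "i < N"
    and D: "multi_affine (D i)" "depends_on V (D i)" "i \<notin> V"
  shows "expected_payoff N (incentive_payoffs N D) i x = x i * D i x"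
proof -
  have "multi_affine (\<lambda>x. x i * D i x)"
    by (rule multi_affine_mult[of _ "{i}" _ V]) (use D in \<open>auto simp: multi_affine_var depends_on_var\<close>)
  then have aff: "(\<lambda>x. x i * D i x) (y(j := t)) = t * (\<lambda>x. x i * D i x) (y(j := 1)) + (1 - t) * (\<lambda>x. x i * D i x) (y(j := 0))" for j y t
    unfolding multi_affine_def by blast
  have "expected_payoff N (incentive_payoffs N D) i x =
    (\<Sum>s\<in>{..<N} \<rightarrow>\<^sub>E UNIV. (\<Prod>j\<in>{..<N}. if s j then x j else 1 - x j) *
      (\<lambda>x. x i * D i x) (\<lambda>j. if j \<in> {..<N} then of_bool (s j) else 0))"
    unfolding expected_payoff_def pure_profiles_def incentive_payoffs_def
    using \<open>i < N\<close> by (intro sum.cong) auto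
  also have "\<dots> = (\<lambda>x. x i * D i x) (\<lambda>j. if j \<in> {..<N} then x j else 0)"
    by (rule expectation_multi_affine[of "{..<N}" "\<lambda>x. x i * D i x" x "\<lambda>_. 0", OF _ aff]) simp
  also have "(\<lambda>j. if j \<in> {..<N} then x j else 0) = x"
    using x by (auto simp: unit_cube_def topspace_Euclidean_space)
  finally show ?thesis .
qed

text \<open>As \<open>D i\<close> ignores the strategy of player \<open>i\<close>, her payoff
  \<open>x i * D i x\<close> is linear in it, and its maximisers on [0, 1] depend on the sign of the
  slope only.\<close>

lemma nash_incentive_payoffs:
  assumes D: "\<And>i. i < N \<Longrightarrow> multi_affine (D i) \<and> depends_on (- {i}) (D i)"
  shows "x \<in> nash_equilibria N (incentive_payoffs N D) \<longleftrightarrow>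
    x \<in> unit_cube N \<and> (\<forall>i<N. (D i x > 0 \<longrightarrow> x i = 1) \<and> (D i x < 0 \<longrightarrow> x i = 0))"
proof -
  have "(\<forall>y\<in>{0..1}. expected_payoff N (incentive_payoffs N D) i (x(i := y)) \<le> expected_payoff N (incentive_payoffs N D) i x) \<longleftrightarrow>
      (D i x > 0 \<longrightarrow> x i = 1) \<and> (D i x < 0 \<longrightarrow> x i = 0)" if x: "x \<in> unit_cube N" and i: "i < N" for i
  proof -
    have xi: "0 \<le> x i" "x i \<le> 1" using x i by (auto simp: unit_cube_def)
    have e: "expected_payoff N (incentive_payoffs N D) i (x(i := y)) = y * D i x" if "y \<in> {0..1}" for y
    proof -
      have "x(i := y) \<in> unit_cube N"
        using x i that by (auto simp: unit_cube_def topspace_Euclidean_space)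
      then show ?thesis
        using expected_incentive_payoffs[of "x(i := y)" N i D "- {i}"] D[OF i] i
          depends_on_upd[of "- {i}" "D i" i x y] by simp
    qed
    have e0: "expected_payoff N (incentive_payoffs N D) i x = x i * D i x"
      using expected_incentive_payoffs[of x N i D "- {i}"] D[OF i] i x by simp
    have "(\<forall>y\<in>{0..1}. y * D i x \<le> x i * D i x) \<longleftrightarrow> (D i x > 0 \<longrightarrow> x i = 1) \<and> (D i x < 0 \<longrightarrow> x i = 0)"
    proof
      assume h: "\<forall>y\<in>{0..1}. y * D i x \<le> x i * D i x"
      have "1 * D i x \<le> x i * D i x" "0 * D i x \<le> x i * D i x" using h by (meson atLeastAtMost_iff order_refl zero_le_one)+
      then show "(D i x > 0 \<longrightarrow> x i = 1) \<and> (D i x < 0 \<longrightarrow> x i = 0)"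
        using xi by (auto simp: mult_le_cancel_right zero_le_mult_iff)
    next
      assume h: "(D i x > 0 \<longrightarrow> x i = 1) \<and> (D i x < 0 \<longrightarrow> x i = 0)"
      show "\<forall>y\<in>{0..1}. y * D i x \<le> x i * D i x"
      proof
        fix y :: real assume y: "y \<in> {0..1}"
        consider "D i x > 0" | "D i x = 0" | "D i x < 0" by linarith
        then show "y * D i x \<le> x i * D i x"
          using h y by cases (auto simp: mult_le_0_iff)
      qed
    qed
    then show ?thesis using e e0 by simp
  qed
  then show ?thesis unfolding nash_equilibria_def by auto
qed

section \<open>Feed-forward circuits with clamped gates\<close>

definition clamp01 :: "real \<Rightarrow> real" where
  "clamp01 r = max 0 (min 1 r)"

lemma clamp01_eq_self: "0 \<le> r \<Longrightarrow> r \<le> 1 \<Longrightarrow> clamp01 r = r"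
  by (simp add: clamp01_def)

lemma clamp01_bounds: "0 \<le> clamp01 r" "clamp01 r \<le> 1"
  by (auto simp: clamp01_def)

lemma clamp01_eq_0_iff: "clamp01 r = 0 \<longleftrightarrow> r \<le> 0"
  by (auto simp: clamp01_def)

text \<open>A circuit \<open>G\<close> with \<open>n\<close> inputs and \<open>m\<close> gates stores the value of gate \<open>k\<close> at index \<open>n + k\<close>.\<close>

definition circuit :: "nat \<Rightarrow> nat \<Rightarrow> (nat \<Rightarrow> (nat \<Rightarrow> real) \<Rightarrow> real) \<Rightarrow> bool" where
  "circuit n m G \<longleftrightarrow> (\<forall>k<m. multi_affine (G k) \<and> depends_on {..<n + k} (G k))"

definition runs :: "nat \<Rightarrow> nat \<Rightarrow> (nat \<Rightarrow> (nat \<Rightarrow> real) \<Rightarrow> real) \<Rightarrow> (nat \<Rightarrow> real) \<Rightarrow> bool" where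
  "runs n m G v \<longleftrightarrow> (\<forall>i<n. 0 \<le> v i \<and> v i \<le> 1) \<and> (\<forall>k<m. v (n + k) = clamp01 (G k v))"

definition extends_circuit ::
  "nat \<Rightarrow> nat \<Rightarrow> (nat \<Rightarrow> (nat \<Rightarrow> real) \<Rightarrow> real) \<Rightarrow> nat \<Rightarrow> (nat \<Rightarrow> (nat \<Rightarrow> real) \<Rightarrow> real) \<Rightarrow> bool" where
  "extends_circuit n m G m' G' \<longleftrightarrow> m \<le> m' \<and> circuit n m' G' \<and> (\<forall>k<m. G' k = G k)"

lemma extends_circuit_refl: "circuit n m G \<Longrightarrow> extends_circuit n m G m G"
  by (simp add: extends_circuit_def)

lemma extends_circuit_trans:
  "extends_circuit n m G m' G' \<Longrightarrow> extends_circuit n m' G' m'' G'' \<Longrightarrow> extends_circuit n m G m'' G''"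
  by (auto simp: extends_circuit_def)

lemma extends_circuit_runs: "extends_circuit n m G m' G' \<Longrightarrow> runs n m' G' v \<Longrightarrow> runs n m G v"
  by (auto simp: extends_circuit_def runs_def)

lemma extends_circuit_gate:
  assumes "circuit n m G" "multi_affine L" "depends_on {..<n + m} L"
  shows "extends_circuit n m G (Suc m) (G(m := L))"
    "runs n (Suc m) (G(m := L)) v \<Longrightarrow> v (n + m) = clamp01 (L v)"
  using assms by (auto simp: extends_circuit_def circuit_def runs_def less_Suc_eq)

lemma runs_exists:
  assumes "circuit n m G" "x \<in> unit_cube n"
  obtains v where "runs n m G v" "proj_first n v = x"
  using assms(1)
proof (induction m arbitrary: thesis)
  case 0
  have "proj_first n x = x"
    using assms(2) by (auto simp: proj_first_def unit_cube_def topspace_Euclidean_space)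
  then show ?case using assms(2)
    by (intro 0(1)[of x]) (auto simp: runs_def unit_cube_def topspace_Euclidean_space)
next
  case (Suc m)
  then obtain v where v: "runs n m G v" "proj_first n v = x"
    by (metis circuit_def less_SucI)
  define v' where "v' = v(n + m := clamp01 (G m v))"
  have dep: "G k v' = G k v" if "k \<le> m" for k
  proof -
    have "depends_on {..<n + k} (G k)" using Suc.prems(2) that by (auto simp: circuit_def)
    then show ?thesis unfolding v'_def using that by (intro depends_on_upd) auto
  qed
  have "runs n (Suc m) G v'"
    using v(1) dep by (auto simp: runs_def less_Suc_eq v'_def)
  moreover have "proj_first n v' = x"
    using v(2) by (auto simp: proj_first_def v'_def)
  ultimately show ?case by (rule Suc.prems(1))
qed

text \<open>The output \<open>L\<close> reads the new gates only, so that two successive computations use disjoint gates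
  and the product of their outputs stays multi-affine.\<close>

definition computable :: "nat \<Rightarrow> ((nat \<Rightarrow> real) \<Rightarrow> real) \<Rightarrow> bool" where
  "computable n \<phi> \<longleftrightarrow> (\<forall>m G. circuit n m G \<longrightarrow> (\<exists>m' G' L. extends_circuit n m G m' G' \<and>
     multi_affine L \<and> depends_on {n + m..<n + m'} L \<and>
     (\<forall>v. runs n m' G' v \<longrightarrow> L v = \<phi> (proj_first n v))))"

lemma computableE:
  assumes "computable n \<phi>" "circuit n m G"
  obtains m' G' L where "extends_circuit n m G m' G'" "multi_affine L"
    "depends_on {n + m..<n + m'} L" "\<And>v. runs n m' G' v \<Longrightarrow> L v = \<phi> (proj_first n v)"
  using assms unfolding computable_def by blast

lemma computable_const: "computable n (\<lambda>x. c)"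
  unfolding computable_def
  using extends_circuit_refl multi_affine_const depends_on_const by blast

text \<open>The output must not read the inputs, so the input is copied into a fresh gate; clamping
  does not alter it since inputs lie in [0, 1]. Repeated occurrences of a variable thus become
  different coordinates, which makes powers computable.\<close>

lemma computable_var:
  assumes "i < n"
  shows "computable n (\<lambda>x. x i)"
  unfolding computable_def
proof (intro allI impI)
  fix m G assume c: "circuit n m G"
  have L: "multi_affine (\<lambda>v. v i)" "depends_on {..<n + m} (\<lambda>v. v i)"
    using assms by (auto simp: multi_affine_var depends_on_var)
  note ext = extends_circuit_gate[OF c L]
  have "v (n + m) = proj_first n v i" if "runs n (Suc m) (G(m := \<lambda>v. v i)) v" for v
    using ext(2)[OF that] that assms by (auto simp: runs_def proj_first_def clamp01_eq_self)
  then show "\<exists>m' G' L. extends_circuit n m G m' G' \<and> multi_affine L \<and>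
      depends_on {n + m..<n + m'} L \<and> (\<forall>v. runs n m' G' v \<longrightarrow> L v = proj_first n v i)"
    using ext(1) multi_affine_var[of "n + m"] depends_on_var[of "n + m" "{n + m..<n + Suc m}"] by force
qed

text \<open>The second computation is appended to the circuit of the first, so the two outputs read
  disjoint blocks of gates and \<open>op\<close> applies.\<close>

lemma computable_combine:
  assumes "computable n \<phi>" "computable n \<psi>"
    and op: "\<And>f g V W. multi_affine f \<Longrightarrow> multi_affine g \<Longrightarrow> depends_on V f \<Longrightarrow> depends_on W g \<Longrightarrow>
      V \<inter> W = {} \<Longrightarrow> multi_affine (\<lambda>x. h (f x) (g x))"
  shows "computable n (\<lambda>x. h (\<phi> x) (\<psi> x))"
  unfolding computable_def
proof (intro allI impI)
  fix m G assume "circuit n m G"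
  then obtain m1 G1 L1 where 1: "extends_circuit n m G m1 G1" "multi_affine L1"
    "depends_on {n + m..<n + m1} L1" "\<And>v. runs n m1 G1 v \<Longrightarrow> L1 v = \<phi> (proj_first n v)"
    using computableE[OF assms(1)] by metis
  then have "circuit n m1 G1" by (simp add: extends_circuit_def)
  then obtain m2 G2 L2 where 2: "extends_circuit n m1 G1 m2 G2" "multi_affine L2"
    "depends_on {n + m1..<n + m2} L2" "\<And>v. runs n m2 G2 v \<Longrightarrow> L2 v = \<psi> (proj_first n v)"
    using computableE[OF assms(2)] by metis
  have le: "m \<le> m1" "m1 \<le> m2" using 1(1) 2(1) by (auto simp: extends_circuit_def)
  have "multi_affine (\<lambda>v. h (L1 v) (L2 v))"
    by (rule op[OF 1(2) 2(2) 1(3) 2(3)]) auto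
  moreover have "depends_on {n + m..<n + m2} (\<lambda>v. h (L1 v) (L2 v))"
    using depends_on_mono[OF 1(3), of "{n + m..<n + m2}"] depends_on_mono[OF 2(3), of "{n + m..<n + m2}"] le
    unfolding depends_on_def by (metis ivl_subset add_le_cancel_left order_refl)
  moreover have "extends_circuit n m G m2 G2" using 1(1) 2(1) extends_circuit_trans by blast
  moreover have "h (L1 v) (L2 v) = h (\<phi> (proj_first n v)) (\<psi> (proj_first n v))" if "runs n m2 G2 v" for v
    using 1(4) 2(4) extends_circuit_runs[OF 2(1)] that by simp
  ultimately show "\<exists>m' G' L. extends_circuit n m G m' G' \<and> multi_affine L \<and>
      depends_on {n + m..<n + m'} L \<and>
      (\<forall>v. runs n m' G' v \<longrightarrow> L v = h (\<phi> (proj_first n v)) (\<psi> (proj_first n v)))"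
    by blast
qed

lemma computable_add: "computable n \<phi> \<Longrightarrow> computable n \<psi> \<Longrightarrow> computable n (\<lambda>x. \<phi> x + \<psi> x)"
  by (rule computable_combine) (auto intro: multi_affine_add)

lemma computable_mult: "computable n \<phi> \<Longrightarrow> computable n \<psi> \<Longrightarrow> computable n (\<lambda>x. \<phi> x * \<psi> x)"
  by (rule computable_combine) (auto intro: multi_affine_mult)

lemma computable_clamp:
  assumes "computable n \<phi>"
  shows "computable n (\<lambda>x. clamp01 (\<phi> x))"
  unfolding computable_def
proof (intro allI impI)
  fix m G assume "circuit n m G"
  then obtain m1 G1 L1 where 1: "extends_circuit n m G m1 G1" "multi_affine L1"
    "depends_on {n + m..<n + m1} L1" "\<And>v. runs n m1 G1 v \<Longrightarrow> L1 v = \<phi> (proj_first n v)"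
    using computableE[OF assms] by metis
  have c: "circuit n m1 G1" and le: "m \<le> m1" using 1(1) by (auto simp: extends_circuit_def)
  have L: "depends_on {..<n + m1} L1" by (rule depends_on_mono[OF 1(3)]) auto
  note ext = extends_circuit_gate[OF c 1(2) L]
  have "v (n + m1) = clamp01 (\<phi> (proj_first n v))" if "runs n (Suc m1) (G1(m1 := L1)) v" for v
    using ext(2)[OF that] 1(4)[OF extends_circuit_runs[OF ext(1) that]] by simp
  moreover have "depends_on {n + m..<n + Suc m1} (\<lambda>v. v (n + m1))"
    using le by (intro depends_on_var) auto
  ultimately show "\<exists>m' G' L. extends_circuit n m G m' G' \<and> multi_affine L \<and>
      depends_on {n + m..<n + m'} L \<and> (\<forall>v. runs n m' G' v \<longrightarrow> L v = clamp01 (\<phi> (proj_first n v)))"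
    using extends_circuit_trans[OF 1(1) ext(1)] multi_affine_var[of "n + m1"] by blast
qed

lemma computable_sum: "(\<And>i. i \<in> I \<Longrightarrow> computable n (\<phi> i)) \<Longrightarrow> computable n (\<lambda>x. \<Sum>i\<in>I. \<phi> i x)"
  by (induction I rule: infinite_finite_induct) (auto intro: computable_add computable_const)

lemma computable_prod: "(\<And>i. i \<in> I \<Longrightarrow> computable n (\<phi> i)) \<Longrightarrow> computable n (\<lambda>x. \<Prod>i\<in>I. \<phi> i x)"
  by (induction I rule: infinite_finite_induct) (auto intro: computable_mult computable_const)

lemma computable_pfun: "pfun {..<n} p \<Longrightarrow> computable n p"
  by (induction rule: pfun.induct)
    (auto intro: computable_const computable_var computable_add computable_mult)

text \<open>The outputs enter payoffs of different players, so they may overlap with each other and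
  only have to avoid the inputs. An input player can then react to her own strategy through a
  copy.\<close>

lemma computable_family:
  fixes r :: nat
  assumes "\<And>i. i < r \<Longrightarrow> computable n (\<phi> i)"
  shows "\<exists>m G L. circuit n m G \<and> (\<forall>i<r. multi_affine (L i) \<and> depends_on {n..<n + m} (L i) \<and>
     (\<forall>v. runs n m G v \<longrightarrow> L i v = \<phi> i (proj_first n v)))"
  using assms
proof (induction r)
  case 0
  have "circuit n 0 (\<lambda>_ _. 0)" by (simp add: circuit_def)
  then show ?case by auto
next
  case (Suc r)
  then obtain m G L where 1: "circuit n m G" "\<And>i. i < r \<Longrightarrow> multi_affine (L i)"
    "\<And>i. i < r \<Longrightarrow> depends_on {n..<n + m} (L i)"
    "\<And>i v. i < r \<Longrightarrow> runs n m G v \<Longrightarrow> L i v = \<phi> i (proj_first n v)"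
    by (metis less_SucI)
  obtain m' G' L' where 2: "extends_circuit n m G m' G'" "multi_affine L'"
    "depends_on {n + m..<n + m'} L'" "\<And>v. runs n m' G' v \<Longrightarrow> L' v = \<phi> r (proj_first n v)"
    using computableE[OF Suc.prems[OF lessI] 1(1)] by metis
  have le: "m \<le> m'" and c: "circuit n m' G'" using 2(1) by (auto simp: extends_circuit_def)
  have "multi_affine ((L(r := L')) i) \<and> depends_on {n..<n + m'} ((L(r := L')) i) \<and>
     (\<forall>v. runs n m' G' v \<longrightarrow> (L(r := L')) i v = \<phi> i (proj_first n v))" if "i < Suc r" for i
  proof (cases "i = r")
    case True
    then show ?thesis using 2 depends_on_mono[OF 2(3), of "{n..<n + m'}"] by auto
  next
    case False
    then have "i < r" using that by simp
    then show ?thesis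
      using False 1 depends_on_mono[OF 1(3), of i "{n..<n + m'}"] le extends_circuit_runs[OF 2(1)] by auto
  qed
  then show ?case using c by blast
qed

section \<open>Compact semi-algebraic sets by closed conditions\<close>

lemma polynomial_fun_pfun: "polynomial_fun n p \<Longrightarrow> pfun {..<n} p"
  unfolding polynomial_fun_def
  by (auto intro!: pfun_sum pfun.mult[OF pfun.const] pfun_prod pfun_power pfun.var)

lemma proj_first_in_topspace: "proj_first n x \<in> topspace (Euclidean_space n)"
  by (simp add: proj_first_def topspace_Euclidean_space)

text \<open>\<open>sgn_determined\<close> concerns arbitrary sequences, so a subset of the
  \<open>n\<close>-dimensional space is replaced by the cylinder over it.\<close>

lemma semialgebraic_sgn_determined:
  "semialgebraic n A \<Longrightarrow> sgn_determined {..<n} {x. proj_first n x \<in> A}"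
proof (induction rule: semialgebraic.induct)
  case (eq_zero p)
  then have p: "pfun {..<n} p" by (rule polynomial_fun_pfun)
  have "{x. proj_first n x \<in> {x \<in> topspace (Euclidean_space n). p x = 0}} = {x. p x = 0}"
    using proj_first_in_topspace proj_first_pfun[OF p] by auto
  then show ?case using sgn_determined_zero[OF p] by simp
next
  case (pos p)
  then have p: "pfun {..<n} p" by (rule polynomial_fun_pfun)
  have "{x. proj_first n x \<in> {x \<in> topspace (Euclidean_space n). p x > 0}} = {x. p x > 0}"
    using proj_first_in_topspace proj_first_pfun[OF p] by auto
  then show ?case using sgn_determined_pos[OF p] by simp
next
  case (union A B)
  then show ?case using sgn_determined_Un[OF union.IH] by (simp add: Collect_disj_eq)
next
  case (inter A B)
  then show ?case using sgn_determined_Int[OF inter.IH] by (simp add: Collect_conj_eq)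
qed

lemma proj_first_unit_cube: "x \<in> unit_cube n \<Longrightarrow> proj_first n x = x"
  by (auto simp: proj_first_def unit_cube_def topspace_Euclidean_space)

lemma compactin_Euclidean_space_imp_compact:
  assumes "compactin (Euclidean_space n) E"
  shows "compact E"
  using assms unfolding Euclidean_space_def compactin_subtopology euclidean_product_topology
  by simp

text \<open>Each sign vector \<open>\<sigma>\<close> of a point of the cube outside \<open>E\<close> is excluded by a closed condition: on
  the part of \<open>E\<close> where no sign is opposite to \<open>\<sigma>\<close>, the product \<open>g\<close> of the polynomials that
  should be nonzero vanishes with the sum \<open>f\<close> of squares of those that should be zero, so that
  \<open>g ^ Suc N \<le> C * f\<close> by the Lojasiewicz inequality.\<close>

lemma compact_semialgebraic_computable:
  assumes E: "compact E" "sgn_determined {..<n} {x. proj_first n x \<in> E}" "E \<subseteq> unit_cube n"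
  obtains \<phi> where "computable n \<phi>" "\<And>x. x \<in> unit_cube n \<Longrightarrow> \<phi> x \<le> 0 \<longleftrightarrow> x \<in> E"
proof -
  obtain Q where Q: "finite Q" "\<And>q. q \<in> Q \<Longrightarrow> pfun {..<n} q"
    "\<And>x x'. sgn_eq Q x x' \<Longrightarrow> x \<in> {x. proj_first n x \<in> E} \<longleftrightarrow> x' \<in> {x. proj_first n x \<in> E}"
    using sgn_determinedE[OF E(2)] by metis
  define vec where "vec x = restrict (\<lambda>q. sgn (q x)) Q" for x :: "nat \<Rightarrow> real"
  define \<Sigma> where "\<Sigma> = vec ` (unit_cube n - E)"
  have "sgn r \<in> {-1, 0, 1}" for r :: real by (simp add: sgn_if)
  then have sub: "\<Sigma> \<subseteq> Q \<rightarrow>\<^sub>E {-1, 0, 1}" unfolding \<Sigma>_def vec_def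
    by (intro image_subsetI) (simp only: restrict_PiE_iff, blast)
  have fin\<Sigma>: "finite \<Sigma>" by (rule finite_subset[OF sub finite_PiE[OF Q(1)]]) simp
  \<comment> \<open>For \<open>\<sigma>\<close> in \<open>\<Sigma>\<close>, a point has sign vector
    \<open>\<sigma>\<close> exactly when all factors of \<open>g \<sigma>\<close> are positive and
    \<open>f \<sigma>\<close> vanishes.\<close>
  define Q1 where "Q1 \<sigma> = {q\<in>Q. \<sigma> q \<noteq> 0}" for \<sigma> :: "((nat \<Rightarrow> real) \<Rightarrow> real) \<Rightarrow> real"
  define f where "f \<sigma> x = (\<Sum>q\<in>Q - Q1 \<sigma>. q x ^ 2)" for \<sigma> and x :: "nat \<Rightarrow> real"
  define g where "g \<sigma> x = (\<Prod>q\<in>Q1 \<sigma>. \<sigma> q * q x)" for \<sigma> and x :: "nat \<Rightarrow> real"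
  have Q1: "Q1 \<sigma> \<subseteq> Q" "finite (Q1 \<sigma>)" for \<sigma> using Q(1) by (auto simp: Q1_def)
  have pq: "pfun {..<n} (\<lambda>x. \<sigma> q * q x)" if "q \<in> Q" for \<sigma> q
    using Q(2)[OF that] by (intro pfun.mult pfun.const)
  have pf: "pfun {..<n} (f \<sigma>)" for \<sigma>
    unfolding f_def[abs_def] using Q(2) by (intro pfun_sum pfun_power) auto
  have pg: "pfun {..<n} (g \<sigma>)" for \<sigma>
    unfolding g_def[abs_def] using Q1(1) pq by (intro pfun_prod) auto
  have "\<exists>N C. \<forall>x\<in>E. (\<forall>q\<in>Q1 \<sigma>. 0 \<le> \<sigma> q * q x) \<longrightarrow> g \<sigma> x ^ Suc N \<le> C * f \<sigma> x" if \<sigma>: "\<sigma> \<in> \<Sigma>" for \<sigma>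
  proof -
    obtain y where y: "y \<in> unit_cube n" "y \<notin> E" "\<sigma> = vec y" using \<sigma> by (auto simp: \<Sigma>_def)
    define P where "P = (\<Inter>q\<in>Q1 \<sigma>. - {x. 0 < - (\<sigma> q * q x)})"
    have inP: "x \<in> P \<longleftrightarrow> (\<forall>q\<in>Q1 \<sigma>. 0 \<le> \<sigma> q * q x)" for x by (auto simp: P_def not_less)
    define A where "A = E \<inter> P"
    have "closed P" unfolding P_def
    proof (intro closed_INT ballI)
      fix q assume q: "q \<in> Q1 \<sigma>"
      have "continuous_on UNIV (\<lambda>x. \<sigma> q * q x)" using pfun_continuous[OF pq] q Q1(1) by blast
      then have "closed {x. 0 \<le> \<sigma> q * q x}" by (intro closed_Collect_le continuous_on_const)
      moreover have "- {x. 0 < - (\<sigma> q * q x)} = {x. 0 \<le> \<sigma> q * q x}" by auto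
      ultimately show "closed (- {x. 0 < - (\<sigma> q * q x)})" by simp
    qed
    then have "compact A" unfolding A_def using E(1) by (rule compact_Int_closed[rotated])
    moreover have "sgn_determined {..<n} {x. proj_first n x \<in> A}"
    proof -
      have "sgn_determined {..<n} P"
        unfolding P_def
        by (intro sgn_determined_INT sgn_determined_Compl sgn_determined_pos pfun_uminus
          pq Q1(2) subsetD[OF Q1(1)])
      moreover have "proj_first n x \<in> P \<longleftrightarrow> x \<in> P" for x
        unfolding inP using proj_first_pfun[OF pq] Q1(1) by (metis (no_types, lifting) subsetD)
      then have "{x. proj_first n x \<in> A} = {x. proj_first n x \<in> E} \<inter> P" by (auto simp: A_def)
      ultimately show ?thesis using E(2) sgn_determined_Int by metis
    qed
    moreover have "proj_first n x = x" if "x \<in> A" for x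
      using that E(3) proj_first_unit_cube by (auto simp: A_def)
    moreover have "f \<sigma> x \<ge> 0" for x by (simp add: f_def sum_nonneg)
    moreover have "g \<sigma> x \<ge> 0" if "x \<in> A" for x
      using that unfolding g_def A_def by (intro prod_nonneg) (auto simp: inP)
    moreover have "g \<sigma> x = 0" if x: "x \<in> A" "f \<sigma> x = 0" for x
    \<comment> \<open>Otherwise \<open>x\<close> in \<open>E\<close> would have the same sign vector
      as \<open>y\<close> outside \<open>E\<close>.\<close>
    proof (rule ccontr)
      assume "g \<sigma> x \<noteq> 0"
      then have nz: "\<sigma> q * q x \<noteq> 0" if "q \<in> Q1 \<sigma>" for q
        using that Q1(2) by (auto simp: g_def)
      have "sgn (q x) = sgn (q y)" if q: "q \<in> Q" for q
      proof (cases "q \<in> Q1 \<sigma>")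
        case True
        have "x \<in> P" using x(1) by (simp add: A_def)
        then have "0 \<le> \<sigma> q * q x" using inP True by blast
        then have "0 < \<sigma> q * q x" using nz[OF True] by (simp only: order_less_le) simp
        moreover have "\<sigma> q = sgn (q y)" using y q by (simp add: vec_def)
        ultimately show ?thesis by (auto simp: sgn_if zero_less_mult_iff split: if_splits)
      next
        case False
        then have "q y = 0" using y q by (simp add: Q1_def vec_def sgn_zero_iff)
        moreover have "q x = 0"
          using x(2) q False Q(1) by (auto simp: f_def sum_nonneg_eq_0_iff)
        ultimately show ?thesis by simp
      qed
      then have "sgn_eq Q x y" by (simp add: sgn_eq_def)
      then show False
        using Q(3)[of x y] x(1) y proj_first_unit_cube[of x n] proj_first_unit_cube[of y n] E(3)
        by (auto simp: A_def)
    qed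
    ultimately have "\<exists>N C. \<forall>x\<in>A. g \<sigma> x ^ Suc N \<le> C * f \<sigma> x"
      using Lojasiewicz_inequality[OF _ _ _ pf pg] by blast
    then obtain N C where "\<forall>x\<in>A. g \<sigma> x ^ Suc N \<le> C * f \<sigma> x" by blast
    then have "\<forall>x\<in>E. (\<forall>q\<in>Q1 \<sigma>. 0 \<le> \<sigma> q * q x) \<longrightarrow> g \<sigma> x ^ Suc N \<le> C * f \<sigma> x"
      using inP unfolding A_def by blast
    then show ?thesis by blast
  qed
  then obtain N C where NC: "\<And>\<sigma> x. \<sigma> \<in> \<Sigma> \<Longrightarrow> x \<in> E \<Longrightarrow> (\<And>q. q \<in> Q1 \<sigma> \<Longrightarrow> 0 \<le> \<sigma> q * q x) \<Longrightarrow>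
      g \<sigma> x ^ Suc (N \<sigma>) \<le> C \<sigma> * f \<sigma> x"
    by metis
  \<comment> \<open>Clamping keeps exactly the positive values positive and sends the others to 0,
    so the products act as conjunctions and the sum as a disjunction of strict inequalities: a
    summand is positive where the signs on \<open>Q1 \<sigma>\<close> agree with
    \<open>\<sigma>\<close> and the Lojasiewicz inequality fails.\<close>
  define \<phi> where "\<phi> x = (\<Sum>\<sigma>\<in>\<Sigma>. clamp01 (g \<sigma> x ^ Suc (N \<sigma>) - C \<sigma> * f \<sigma> x) *
      (\<Prod>q\<in>Q1 \<sigma>. clamp01 (\<sigma> q * q x)))" for x
  have nonneg: "0 \<le> clamp01 (g \<sigma> x ^ Suc (N \<sigma>) - C \<sigma> * f \<sigma> x) * (\<Prod>q\<in>Q1 \<sigma>. clamp01 (\<sigma> q * q x))" for \<sigma> x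
    by (intro mult_nonneg_nonneg prod_nonneg clamp01_bounds ballI)
  show thesis
  proof (rule that)
    show "computable n \<phi>"
      unfolding \<phi>_def[abs_def]
    proof (intro computable_sum computable_mult computable_prod computable_clamp computable_pfun)
      show "pfun {..<n} (\<lambda>x. g \<sigma> x ^ Suc (N \<sigma>) - C \<sigma> * f \<sigma> x)" for \<sigma>
        by (intro pfun_diff pfun_power pfun.mult pfun.const pf pg)
    qed (auto intro: pfun.const Q(2) subsetD[OF Q1(1)])
  next
    fix x assume x: "x \<in> unit_cube n"
    show "\<phi> x \<le> 0 \<longleftrightarrow> x \<in> E"
    proof
      assume xE: "x \<in> E"
      have "clamp01 (g \<sigma> x ^ Suc (N \<sigma>) - C \<sigma> * f \<sigma> x) * (\<Prod>q\<in>Q1 \<sigma>. clamp01 (\<sigma> q * q x)) = 0" if "\<sigma> \<in> \<Sigma>" for \<sigma>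
      proof (cases "\<forall>q\<in>Q1 \<sigma>. 0 < \<sigma> q * q x")
        case True
        then have "g \<sigma> x ^ Suc (N \<sigma>) \<le> C \<sigma> * f \<sigma> x" by (intro NC[OF that xE]) (auto intro: less_imp_le)
        then have "clamp01 (g \<sigma> x ^ Suc (N \<sigma>) - C \<sigma> * f \<sigma> x) = 0" unfolding clamp01_eq_0_iff by simp
        then show ?thesis by simp
      next
        case False
        then obtain q where "q \<in> Q1 \<sigma>" "clamp01 (\<sigma> q * q x) = 0"
          unfolding clamp01_eq_0_iff by (auto simp: not_less)
        then have "(\<Prod>q\<in>Q1 \<sigma>. clamp01 (\<sigma> q * q x)) = 0" using Q1(2) by (intro prod_zero) auto
        then show ?thesis by simp
      qed
      then show "\<phi> x \<le> 0" unfolding \<phi>_def by (intro sum_nonpos eq_refl)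
    next
      assume le: "\<phi> x \<le> 0"
      show "x \<in> E"
      proof (rule ccontr)
        assume "x \<notin> E"
        define \<sigma> where "\<sigma> = vec x"
        have \<sigma>: "\<sigma> \<in> \<Sigma>" using x \<open>x \<notin> E\<close> by (simp add: \<sigma>_def \<Sigma>_def)
        have pos: "0 < \<sigma> q * q x" if "q \<in> Q1 \<sigma>" for q
        proof -
          have "q \<in> Q" "\<sigma> q \<noteq> 0" using that by (auto simp: Q1_def)
          then have "\<sigma> q = sgn (q x)" by (simp add: \<sigma>_def vec_def)
          then show ?thesis using \<open>\<sigma> q \<noteq> 0\<close> by (auto simp: sgn_if split: if_splits)
        qed
        have "q x = 0" if "q \<in> Q - Q1 \<sigma>" for q
          using that by (auto simp: Q1_def \<sigma>_def vec_def sgn_zero_iff)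
        then have "f \<sigma> x = 0" unfolding f_def by (intro sum.neutral) auto
        moreover have "g \<sigma> x > 0" unfolding g_def using pos by (intro prod_pos) auto
        ultimately have "\<not> g \<sigma> x ^ Suc (N \<sigma>) - C \<sigma> * f \<sigma> x \<le> 0" by (simp add: not_le del: power_Suc)
        then have "0 < clamp01 (g \<sigma> x ^ Suc (N \<sigma>) - C \<sigma> * f \<sigma> x)"
          using clamp01_eq_0_iff clamp01_bounds(1) by (metis order_le_less)
        moreover have "0 < clamp01 (\<sigma> q * q x)" if "q \<in> Q1 \<sigma>" for q
          using clamp01_eq_0_iff clamp01_bounds(1) pos[OF that] by (metis order_le_less not_less)
        then have "0 < (\<Prod>q\<in>Q1 \<sigma>. clamp01 (\<sigma> q * q x))" by (intro prod_pos) auto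
        ultimately have "0 < clamp01 (g \<sigma> x ^ Suc (N \<sigma>) - C \<sigma> * f \<sigma> x) * (\<Prod>q\<in>Q1 \<sigma>. clamp01 (\<sigma> q * q x))"
          by (rule mult_pos_pos)
        also have "\<dots> \<le> \<phi> x"
          unfolding \<phi>_def using fin\<Sigma> \<sigma> nonneg
          by (intro member_le_sum[of \<sigma> \<Sigma> "\<lambda>\<sigma>. clamp01 (g \<sigma> x ^ Suc (N \<sigma>) - C \<sigma> * f \<sigma> x) * (\<Prod>q\<in>Q1 \<sigma>. clamp01 (\<sigma> q * q x))"]) auto
        finally show False using le by simp
      qed
    qed
  qed
qed

section \<open>The game\<close>

text \<open>The player of \<open>y\<close> follows \<open>z\<close>, while the player of
  \<open>z\<close> gains from pushing \<open>y\<close> towards \<open>r\<close>. If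
  \<open>y < r\<close>, then \<open>z = 1\<close>, hence \<open>y = 1\<close> and
  \<open>r > 1\<close>; the case \<open>r < y\<close> is symmetric. An unclamped mismatch cannot
  persist.\<close>

lemma matching_pennies_clamp:
  fixes y z r :: real
  assumes y: "0 \<le> y" "y \<le> 1"
    and eqy: "z - 1 / 2 > 0 \<Longrightarrow> y = 1" "z - 1 / 2 < 0 \<Longrightarrow> y = 0"
    and eqz: "r - y > 0 \<Longrightarrow> z = 1" "r - y < 0 \<Longrightarrow> z = 0"
  shows "y = clamp01 r"
proof -
  consider "r > y" | "r < y" | "r = y" by linarith
  then show ?thesis
  proof cases
    case 1
    then have "y = 1" using eqz(1) eqy(1) by simp
    then show ?thesis using 1 by (simp add: clamp01_def)
  next
    case 2
    then have "y = 0" using eqz(2) eqy(2) by simp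
    then show ?thesis using 2 by (simp add: clamp01_def)
  next
    case 3
    then show ?thesis using y by (simp add: clamp01_eq_self)
  qed
qed

text \<open>The players are the \<open>n\<close> inputs, a player \<open>n + k\<close> holding the value of gate \<open>k\<close>, a partner
  \<open>n + m + k\<close> who forces this value, and a player \<open>n + 2 * m\<close> who watches \<open>\<phi>\<close>. As long as the
  watcher uses her first strategy with positive probability, the inputs are drawn to the point
  \<open>c\<close>; she may abstain only if \<open>\<phi> \<le> 0\<close>, and then the inputs are indifferent.\<close>

lemma computable_game:
  assumes comp: "computable n \<phi>"
    and E: "\<And>x. x \<in> unit_cube n \<Longrightarrow> \<phi> x \<le> 0 \<longleftrightarrow> x \<in> E" "E \<subseteq> unit_cube n"
    and c: "c \<in> E"
  shows "\<exists>(N :: nat) (u :: payoffs). N > n \<and> proj_first n ` nash_equilibria N u = E"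
proof -
  \<comment> \<open>Indices below \<open>n\<close> stand for copies of the inputs: as an incentive
    may not depend on the player's own strategy, input \<open>i\<close> is compared with
    \<open>c i\<close> through its copy. Index \<open>n\<close> is the watched function.\<close>
  define \<psi> :: "nat \<Rightarrow> (nat \<Rightarrow> real) \<Rightarrow> real" where "\<psi> i = (if i = n then \<phi> else (\<lambda>x. x i))" for i
  have "computable n (\<psi> i)" if "i < Suc n" for i
    using that comp computable_var by (auto simp: \<psi>_def less_Suc_eq)
  then obtain m G L where circ: "circuit n m G"
    and L: "\<And>i. i < Suc n \<Longrightarrow> multi_affine (L i)" "\<And>i. i < Suc n \<Longrightarrow> depends_on {n..<n + m} (L i)"
    and Lv: "\<And>i v. i < Suc n \<Longrightarrow> runs n m G v \<Longrightarrow> L i v = \<psi> i (proj_first n v)"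
    using computable_family[of "Suc n" n \<psi>] by metis
  have Lin: "L i v = v i" if "i < n" "runs n m G v" for i v
    using Lv[of i v] that by (simp add: \<psi>_def proj_first_def)
  have L\<phi>: "L n v = \<phi> (proj_first n v)" if "runs n m G v" for v
    using Lv[of n v] that by (simp add: \<psi>_def)
  define N where "N = n + 2 * m + 1"
  define D :: "nat \<Rightarrow> (nat \<Rightarrow> real) \<Rightarrow> real" where
    "D i = (if i < n then (\<lambda>x. x (n + 2 * m) * (c i - L i x))
      else if i < n + m then (\<lambda>x. x (i + m) - 1 / 2)
      else if i < n + 2 * m then (\<lambda>x. G (i - n - m) x - x (i - m))
      else L n)" for i
  have D_in: "D i = (\<lambda>x. x (n + 2 * m) * (c i - L i x))" if "i < n" for i
    using that by (simp add: D_def)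
  have D_gate: "D (n + k) = (\<lambda>x. x (n + m + k) - 1 / 2)" if "k < m" for k
    using that by (simp add: D_def add.commute add.left_commute)
  have D_force: "D (n + m + k) = (\<lambda>x. G k x - x (n + k))" if "k < m" for k
    using that by (simp add: D_def)
  have D_watch: "D (n + 2 * m) = L n" by (simp add: D_def)
  have players: "P i" if iN: "i < N" and "i < n \<Longrightarrow> P i" "\<And>k. k < m \<Longrightarrow> i = n + k \<Longrightarrow> P i"
      "\<And>k. k < m \<Longrightarrow> i = n + m + k \<Longrightarrow> P i" "i = n + 2 * m \<Longrightarrow> P i" for i and P :: "nat \<Rightarrow> bool"
  proof -
    consider "i < n" | "i - n < m" "i = n + (i - n)" | "i - n - m < m" "i = n + m + (i - n - m)" | "i = n + 2 * m"
      using iN unfolding N_def by linarith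
    then show "P i" using that(2-) by cases blast+
  qed
  have Dok: "multi_affine (D i) \<and> depends_on (- {i}) (D i)" if "i < N" for i
  proof (rule players[OF that])
    assume i: "i < n"
    have "multi_affine (\<lambda>x. x (n + 2 * m) * (c i - L i x))"
      using i L by (intro multi_affine_mult[of _ "{n + 2 * m}" _ "{n..<n + m}"] multi_affine_diff
        multi_affine_var multi_affine_const depends_on_var depends_on_diff depends_on_const) auto
    moreover have "depends_on (- {i}) (\<lambda>x. x (n + 2 * m) * (c i - L i x))"
      using i depends_on_mono[OF L(2)[of i], of "- {i}"]
      by (intro depends_on_mult depends_on_diff depends_on_var depends_on_const) auto
    ultimately show ?thesis by (simp add: D_in i)
  next
    fix k assume k: "k < m" "i = n + k"
    then show ?thesis
      unfolding k(2) D_gate[OF k(1)]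
      by (intro conjI multi_affine_diff multi_affine_var multi_affine_const depends_on_diff
        depends_on_var depends_on_const) auto
  next
    fix k assume k: "k < m" "i = n + m + k"
    have G: "multi_affine (G k)" "depends_on {..<n + k} (G k)" using circ k by (auto simp: circuit_def)
    have "depends_on (- {n + m + k}) (G k)" by (rule depends_on_mono[OF G(2)]) auto
    then show ?thesis
      unfolding k(2) D_force[OF k(1)] using G(1) k
      by (intro conjI multi_affine_diff multi_affine_var depends_on_diff depends_on_var) auto
  next
    assume i: "i = n + 2 * m"
    have "depends_on (- {n + 2 * m}) (L n)" by (rule depends_on_mono[OF L(2)]) auto
    then show ?thesis unfolding i D_watch using L(1) by simp
  qed
  define u where "u = incentive_payoffs N D"
  have nash: "x \<in> nash_equilibria N u \<longleftrightarrow>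
    x \<in> unit_cube N \<and> (\<forall>i<N. (D i x > 0 \<longrightarrow> x i = 1) \<and> (D i x < 0 \<longrightarrow> x i = 0))" for x
    unfolding u_def by (rule nash_incentive_payoffs) (rule Dok)
  have "proj_first n x \<in> E" if x: "x \<in> nash_equilibria N u" for x
  proof -
    have br: "D i x > 0 \<Longrightarrow> x i = 1" "D i x < 0 \<Longrightarrow> x i = 0" if "i < N" for i
      using x that unfolding nash by auto
    have b: "0 \<le> x i" "x i \<le> 1" if "i < N" for i
      using x that unfolding nash by (auto simp: unit_cube_def)
    have run: "runs n m G x"
      unfolding runs_def
    proof (intro conjI allI impI)
      show "0 \<le> x i" "x i \<le> 1" if "i < n" for i using b that by (auto simp: N_def)
      fix k assume k: "k < m"
      show "x (n + k) = clamp01 (G k x)"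
      proof (rule matching_pennies_clamp)
        have lt: "n + k < N" "n + m + k < N" using k by (auto simp: N_def)
        show "0 \<le> x (n + k)" "x (n + k) \<le> 1" using b[OF lt(1)] by auto
        show "x (n + m + k) - 1 / 2 > 0 \<Longrightarrow> x (n + k) = 1" "x (n + m + k) - 1 / 2 < 0 \<Longrightarrow> x (n + k) = 0"
          using br[OF lt(1)] unfolding D_gate[OF k] by blast+
        show "G k x - x (n + k) > 0 \<Longrightarrow> x (n + m + k) = 1" "G k x - x (n + k) < 0 \<Longrightarrow> x (n + m + k) = 0"
          using br[OF lt(2)] unfolding D_force[OF k] by blast+
      qed
    qed
    have px: "proj_first n x \<in> unit_cube n"
      using b by (auto simp: proj_first_def unit_cube_def topspace_Euclidean_space N_def)
    show ?thesis
    proof (cases "x (n + 2 * m) = 0")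
      case True
      then have "\<not> D (n + 2 * m) x > 0" using br(1)[of "n + 2 * m"] by (auto simp: N_def)
      then show ?thesis using E(1)[OF px] L\<phi>[OF run] by (simp add: D_watch)
    next
      case False
      then have w: "x (n + 2 * m) > 0" using b(1)[of "n + 2 * m"] by (simp add: N_def)
      have cb: "0 \<le> c i" "c i \<le> 1" if "i < n" for i using c E(2) that by (auto simp: unit_cube_def)
      \<comment> \<open>Below \<open>c i\<close> the incentive is positive and forces
        \<open>x i = 1\<close>, contradicting \<open>c i \<le> 1\<close>; above \<open>c i\<close>
        it forces 0, contradicting \<open>0 \<le> c i\<close>.\<close>
      have "x i = c i" if i: "i < n" for i
      proof -
        have iN: "i < N" using i by (simp add: N_def)
        have D: "D i x = x (n + 2 * m) * (c i - x i)" using D_in[OF i] Lin[OF i run] by simp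
        have "x i = 1" if "x i < c i"
          by (rule br(1)[OF iN]) (unfold D, rule mult_pos_pos, use w that in simp_all)
        moreover have "x i = 0" if "c i < x i"
          by (rule br(2)[OF iN]) (unfold D, rule mult_pos_neg, use w that in simp_all)
        ultimately show ?thesis using cb[OF i] by fastforce
      qed
      then have "proj_first n x = proj_first n c" by (auto simp: proj_first_def)
      also have "\<dots> = c" using c E(2) proj_first_unit_cube by blast
      finally show ?thesis using c by simp
    qed
  qed
  moreover have "x \<in> proj_first n ` nash_equilibria N u" if xE: "x \<in> E" for x
  proof -
    have x: "x \<in> unit_cube n" using xE E(2) by blast
    obtain v where v: "runs n m G v" "proj_first n v = x" using runs_exists[OF circ x] by metis
    \<comment> \<open>If the gate function has its value in [0, 1], its partner plays 1/2 and the
      gate player is indifferent; otherwise the partner pushes the gate to the clamped end.\<close>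
    define z :: "nat \<Rightarrow> real" where "z k = (if G k v < 0 then 0 else if G k v > 1 then 1 else 1 / 2)" for k
    \<comment> \<open>The final 0 is also the strategy of the watcher and switches off the
      incentives of all inputs.\<close>
    define X where "X j = (if j < n + m then v j else if j < n + 2 * m then z (j - n - m) else 0)" for j
    have GX: "G k X = G k v" if "k < m" for k
    proof -
      have "depends_on {..<n + k} (G k)" using circ that by (auto simp: circuit_def)
      then show ?thesis using that unfolding depends_on_def X_def by simp
    qed
    have run: "runs n m G X" using v(1) GX by (auto simp: runs_def X_def)
    have pX: "proj_first n X = x" using v(2) by (auto simp: proj_first_def X_def)
    have Xz: "X (n + m + k) = z k" if "k < m" for k using that by (simp add: X_def)
    have Xv: "X (n + k) = clamp01 (G k v)" if "k < m" for k using run GX that by (simp add: runs_def)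
    have "0 \<le> X i \<and> X i \<le> 1" if "i < N" for i
    proof (rule players[OF that])
      show "0 \<le> X i \<and> X i \<le> 1" if "i < n" using run that by (auto simp: runs_def)
      show "0 \<le> X i \<and> X i \<le> 1" if "k < m" "i = n + k" for k
        using Xv that clamp01_bounds by simp
      show "0 \<le> X i \<and> X i \<le> 1" if "k < m" "i = n + m + k" for k
        using Xz that by (simp add: z_def)
      show "0 \<le> X i \<and> X i \<le> 1" if "i = n + 2 * m" using that by (simp add: X_def)
    qed
    then have cube: "X \<in> unit_cube N"
      by (auto simp: unit_cube_def topspace_Euclidean_space X_def N_def)
    have "(D i X > 0 \<longrightarrow> X i = 1) \<and> (D i X < 0 \<longrightarrow> X i = 0)" if "i < N" for i
    proof (rule players[OF that])
      assume i: "i < n"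
      have "D i X = 0" using D_in[OF i] by (simp add: X_def)
      then show ?thesis by simp
    next
      fix k assume k: "k < m" "i = n + k"
      show ?thesis
        unfolding k(2) D_gate[OF k(1)] Xz[OF k(1)] Xv[OF k(1)] by (auto simp: z_def clamp01_def)
    next
      fix k assume k: "k < m" "i = n + m + k"
      show ?thesis
        unfolding k(2) D_force[OF k(1)] Xz[OF k(1)] Xv[OF k(1)] GX[OF k(1)]
        by (auto simp: z_def clamp01_def)
    next
      assume i: "i = n + 2 * m"
      have "D i X \<le> 0" using E(1)[OF x] xE L\<phi>[OF run] pX by (simp add: i D_watch)
      moreover have "X i = 0" by (simp add: i X_def)
      ultimately show ?thesis by simp
    qed
    then have "X \<in> nash_equilibria N u" using cube unfolding nash by blast
    then show ?thesis using pX by blast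
  qed
  ultimately have "proj_first n ` nash_equilibria N u = E" by blast
  then show ?thesis by (intro exI[of _ N] exI[of _ u]) (simp add: N_def)
qed

theorem proposition1:
  fixes n :: nat and E :: "(nat \<Rightarrow> real) set"
  assumes "n \<ge> 1"
    and "E \<noteq> {}"
    and "compactin (Euclidean_space n) E"
    and "semialgebraic n E"
    and "E \<subseteq> unit_cube n"
  shows "\<exists>(N :: nat) (u :: payoffs). N > n \<and> proj_first n ` nash_equilibria N u = E"
proof -
  obtain \<phi> where "computable n \<phi>" "\<And>x. x \<in> unit_cube n \<Longrightarrow> \<phi> x \<le> 0 \<longleftrightarrow> x \<in> E"
    using compact_semialgebraic_computable[OF compactin_Euclidean_space_imp_compact[OF assms(3)]
      semialgebraic_sgn_determined[OF assms(4)] assms(5)] by metis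
  moreover obtain c where "c \<in> E" using assms(2) by blast
  ultimately show ?thesis using computable_game assms(5) by blast
qed

end
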